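(* Let $\mathcal{I}$ be the species of interval orders and put $q=x_1+\frac{x_2}{2}+\frac{x_3}{3}+\cdots$. (a) The generating series of $\mathcal{I}$ (for labeled interval orders) is $$\mathcal{I}(x)=\sum_{m\geq 0}\prod_{i=1}^{m}\bigl(1-e^{-ix}\bigr).$$ (b) The type generating series of $\mathcal{I}$ is $$\widetilde{\mathcal{I}}(x)=\sum_{m\geq 0}\prod_{i=1}^{m}\bigl(1-(1-x)^i\bigr).$$ (c) The cycle index series of $\mathcal{I}$ is $$Z_{\mathcal{I}}=\sum_{m\geq 0}\prod_{i=1}^{m}\bigl(1-e^{-iq}\bigr)=\mathcal{I}(q).$$
   Context: $\mathcal{I}[U]$ is the set of interval orders on the finite set $U$, i.e. $(2{+}2)$-free posets: irreflexive transitive relations on $U$ with no induced subposet isomorphic to the disjoint union of two two-element chains. A bijection $\sigma\colon U\to V$ transports $P$ to $\sigma\cdot P=\{(\sigma x,\sigma y):(x,y)\in P\}$; this makes $\mathcal{I}$ a species (a functor from finite sets with bijections to finite sets). Write $\mathcal{I}[n]=\mathcal{I}[\{1,\dots,n\}]$. For a species $F$: the generating series is $F(x)=\sum_{n\ge0}|F[n]|\frac{x^n}{n!}$; the type generating series is $\widetilde F(x)=\sum_{n\ge0}|F[n]/\!\sim|\,x^n$, where $\sim$ is isomorphism of structures ($s\sim t$ iff $\sigma\cdot s=t$ for some $\sigma$); the cycle index series is $Z_F(x_1,x_2,\dots)=\sum_{n\ge0}\frac1{n!}\sum_{\sigma\in\mathcal{S}_n}\mathrm{fix}\,F[\sigma]\,x_1^{\sigma_1}x_2^{\sigma_2}\cdots$,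 where $\mathrm{fix}\,F[\sigma]$ is the number of $F$-structures on $[n]$ fixed by $\sigma$ and $\sigma_j$ is the number of cycles of $\sigma$ of length $j$. All series are formal power series and $\mathcal{I}(q)$ denotes substitution of $q$ for $x$ in $\mathcal{I}(x)$. *)

theory Defs
  imports
    "HOL-Computational_Algebra.Formal_Power_Series"
    "HOL-Combinatorics.Orbits"
    "HOL-Library.Multiset"
begin

section \<open>Formal power series in arbitrarily many variables\<close>

text \<open>
  The monomials in commuting variables indexed by \<open>'v\<close> are the finite multisets over \<open>'v\<close>
  (the monomial \<open>x\<^sub>1\<^sup>2 x\<^sub>3\<close> is \<open>{#1, 1, 3#}\<close>), and a power series is an arbitrary family of
  coefficients indexed by monomials.
\<close>

typedef ('v, 'a) mfps = "UNIV :: ('v multiset \<Rightarrow> 'a) set"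
  morphisms mfps_coeff Abs_mfps
  by simp

lemma mfps_coeff_Abs [simp]: "mfps_coeff (Abs_mfps f) = f"
  by (simp add: Abs_mfps_inverse)

lemma mfps_eqI: "(\<And>m. mfps_coeff f m = mfps_coeff g m) \<Longrightarrow> f = g"
  by (metis mfps_coeff_inject ext)

lemma finite_submultisets: "finite {A. A \<subseteq># M}"
proof (induction M)
  case empty
  then show ?case by simp
next
  case (add x M)
  have "{A. A \<subseteq># add_mset x M} \<subseteq> {A. A \<subseteq># M} \<union> add_mset x ` {A. A \<subseteq># M}"
  proof
    fix A assume "A \<in> {A. A \<subseteq># add_mset x M}"
    then have A: "A \<subseteq># add_mset x M" by simp
    show "A \<in> {A. A \<subseteq># M} \<union> add_mset x ` {A. A \<subseteq># M}"
    proof (cases "x \<in># A")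
      case True
      then obtain B where "A = add_mset x B" by (meson mset_add)
      with A show ?thesis by auto
    next
      case False
      have "count A y \<le> count M y" for y
        using mset_subset_eq_count[OF A, of y] False by (cases "y = x") (auto simp: not_in_iff)
      then show ?thesis by (auto intro: mset_subset_eqI)
    qed
  qed
  then show ?case using add.IH finite_subset by blast
qed

definition msplits :: "'v multiset \<Rightarrow> ('v multiset \<times> 'v multiset) set" where
  "msplits m = {(a, b). a + b = m}"

lemma finite_msplits [simp]: "finite (msplits m)"
  by (rule finite_subset[of _ "{A. A \<subseteq># m} \<times> {A. A \<subseteq># m}"])
     (auto simp: msplits_def finite_submultisets)

lemma sum_msplits_assoc:
  fixes h :: "'v multiset \<Rightarrow> 'v multiset \<Rightarrow> 'v multiset \<Rightarrow> 'a::comm_monoid_add"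
  shows "(\<Sum>(p, c)\<in>msplits m. \<Sum>(a, b)\<in>msplits p. h a b c) =
         (\<Sum>(a, p)\<in>msplits m. \<Sum>(b, c)\<in>msplits p. h a b c)"
proof -
  have "(\<Sum>(p, c)\<in>msplits m. \<Sum>(a, b)\<in>msplits p. h a b c) =
        (\<Sum>x\<in>Sigma (msplits m) (\<lambda>x. msplits (fst x)).
           h (fst (snd x)) (snd (snd x)) (snd (fst x)))"
    by (simp add: sum.Sigma case_prod_unfold)
  also have "\<dots> = (\<Sum>x\<in>Sigma (msplits m) (\<lambda>x. msplits (snd x)).
           h (fst (fst x)) (fst (snd x)) (snd (snd x)))"
    by (rule sum.reindex_bij_witness
          [where i = "\<lambda>((a, p), (b, c)). ((a + b, c), (a, b))"
             and j = "\<lambda>((p, c), (a, b)). ((a, b + c), (b, c))"])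
       (auto simp: msplits_def add.assoc)
  also have "\<dots> = (\<Sum>(a, p)\<in>msplits m. \<Sum>(b, c)\<in>msplits p. h a b c)"
    by (simp add: sum.Sigma case_prod_unfold)
  finally show ?thesis .
qed

definition mfps_const :: "'a::zero \<Rightarrow> ('v, 'a) mfps" where
  "mfps_const c = Abs_mfps (\<lambda>m. if m = {#} then c else 0)"

definition mfps_var :: "'v \<Rightarrow> ('v, 'a::zero_neq_one) mfps" where
  "mfps_var v = Abs_mfps (\<lambda>m. if m = {#v#} then 1 else 0)"

instantiation mfps :: (type, comm_ring_1) comm_ring_1
begin

definition "0 = Abs_mfps (\<lambda>m. 0)"
definition "1 = Abs_mfps (\<lambda>m. if m = {#} then 1 else 0)"
definition "f + g = Abs_mfps (\<lambda>m. mfps_coeff f m + mfps_coeff g m)"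
definition "f - g = Abs_mfps (\<lambda>m. mfps_coeff f m - mfps_coeff g m)"
definition "- f = Abs_mfps (\<lambda>m. - mfps_coeff f m)"
definition "f * g = Abs_mfps (\<lambda>m. \<Sum>(a, b)\<in>msplits m. mfps_coeff f a * mfps_coeff g b)"

lemma mfps_coeff_simps [simp]:
  "mfps_coeff (0 :: ('a, 'b) mfps) m = 0"
  "mfps_coeff (1 :: ('a, 'b) mfps) m = (if m = {#} then 1 else 0)"
  "mfps_coeff (f + g :: ('a, 'b) mfps) m = mfps_coeff f m + mfps_coeff g m"
  "mfps_coeff (f - g :: ('a, 'b) mfps) m = mfps_coeff f m - mfps_coeff g m"
  "mfps_coeff (- f :: ('a, 'b) mfps) m = - mfps_coeff f m"
  by (simp_all add: zero_mfps_def one_mfps_def plus_mfps_def minus_mfps_def uminus_mfps_def)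

lemma mfps_coeff_mult:
  "mfps_coeff (f * g :: ('a, 'b) mfps) m =
     (\<Sum>(a, b)\<in>msplits m. mfps_coeff f a * mfps_coeff g b)"
  by (simp add: times_mfps_def)

instance
proof
  fix f g h :: "('a, 'b) mfps"
  show "f * g * h = f * (g * h)"
  proof (rule mfps_eqI)
    fix m
    show "mfps_coeff (f * g * h) m = mfps_coeff (f * (g * h)) m"
      using sum_msplits_assoc
        [of "\<lambda>a b c. mfps_coeff f a * mfps_coeff g b * mfps_coeff h c" m]
      by (simp add: mfps_coeff_mult sum_distrib_left sum_distrib_right case_prod_unfold mult.assoc)
  qed
  show "f * g = g * f"
  proof (rule mfps_eqI)
    fix m
    show "mfps_coeff (f * g) m = mfps_coeff (g * f) m"
      unfolding mfps_coeff_mult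
      by (rule sum.reindex_bij_witness[where i = prod.swap and j = prod.swap])
         (auto simp: msplits_def add.commute mult.commute)
  qed
  show "1 * f = f"
  proof (rule mfps_eqI)
    fix m
    have "mfps_coeff (1 * f) m =
          (\<Sum>x\<in>msplits m. if x = ({#}, m) then mfps_coeff f m else 0)"
      unfolding mfps_coeff_mult by (rule sum.cong) (auto simp: msplits_def split: if_splits)
    also have "\<dots> = mfps_coeff f m"
      by (subst sum.delta) (simp_all, simp add: msplits_def)
    finally show "mfps_coeff (1 * f) m = mfps_coeff f m" .
  qed
  show "(f + g) * h = f * h + g * h"
    by (rule mfps_eqI)
       (simp add: mfps_coeff_mult case_prod_unfold distrib_right sum.distrib)
  show "(0 :: ('a, 'b) mfps) \<noteq> 1"
  proof
    assume "(0 :: ('a, 'b) mfps) = 1"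
    then have "mfps_coeff (0 :: ('a, 'b) mfps) {#} = mfps_coeff 1 {#}" by simp
    then show False by simp
  qed
qed (auto intro!: mfps_eqI simp: algebra_simps)

end

text \<open>
  The usual topology on formal power series: the product topology with respect to discrete
  coefficients. A sequence converges iff every coefficient is eventually constant.
\<close>

instantiation mfps :: (type, type) t2_space
begin

definition open_mfps :: "('a, 'b) mfps set \<Rightarrow> bool" where
  "open_mfps U \<longleftrightarrow>
     (\<forall>f\<in>U. \<exists>A. finite A \<and> (\<forall>g. (\<forall>m\<in>A. mfps_coeff g m = mfps_coeff f m) \<longrightarrow> g \<in> U))"

instance
proof
  show "open (UNIV :: ('a, 'b) mfps set)"
    by (auto simp: open_mfps_def)
next
  fix S T :: "('a, 'b) mfps set"
  assume S: "open S" and T: "open T"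
  show "open (S \<inter> T)"
    unfolding open_mfps_def
  proof
    fix f assume f: "f \<in> S \<inter> T"
    from S f obtain A where
      "finite A" "\<And>g. (\<forall>m\<in>A. mfps_coeff g m = mfps_coeff f m) \<longrightarrow> g \<in> S"
      unfolding open_mfps_def by blast
    moreover from T f obtain B where
      "finite B" "\<And>g. (\<forall>m\<in>B. mfps_coeff g m = mfps_coeff f m) \<longrightarrow> g \<in> T"
      unfolding open_mfps_def by blast
    ultimately show
      "\<exists>A. finite A \<and> (\<forall>g. (\<forall>m\<in>A. mfps_coeff g m = mfps_coeff f m) \<longrightarrow> g \<in> S \<inter> T)"
      by (intro exI[of _ "A \<union> B"]) auto
  qed
next
  fix K :: "('a, 'b) mfps set set"
  assume K: "\<forall>S\<in>K. open S"
  show "open (\<Union>K)"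
    unfolding open_mfps_def
  proof
    fix f assume "f \<in> \<Union>K"
    then obtain S where S: "S \<in> K" "f \<in> S" by blast
    with K obtain A where
      "finite A" "\<forall>g. (\<forall>m\<in>A. mfps_coeff g m = mfps_coeff f m) \<longrightarrow> g \<in> S"
      unfolding open_mfps_def by meson
    with S show
      "\<exists>A. finite A \<and> (\<forall>g. (\<forall>m\<in>A. mfps_coeff g m = mfps_coeff f m) \<longrightarrow> g \<in> \<Union>K)"
      by blast
  qed
next
  fix f g :: "('a, 'b) mfps"
  assume "f \<noteq> g"
  then obtain m where m: "mfps_coeff f m \<noteq> mfps_coeff g m" using mfps_eqI by blast
  let ?U = "\<lambda>f :: ('a, 'b) mfps. {h. mfps_coeff h m = mfps_coeff f m}"
  have "open (?U f)" for f
    unfolding open_mfps_def by (auto intro!: exI[of _ "{m}"])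
  moreover have "f \<in> ?U f" "g \<in> ?U g" "?U f \<inter> ?U g = {}" using m by auto
  ultimately show "\<exists>U V. open U \<and> open V \<and> f \<in> U \<and> g \<in> V \<and> U \<inter> V = {}" by blast
qed

end

lemma mfps_tendsto_iff:
  "(X \<longlongrightarrow> f) F \<longleftrightarrow> (\<forall>m. eventually (\<lambda>n. mfps_coeff (X n) m = mfps_coeff f m) F)"
proof
  assume L: "(X \<longlongrightarrow> f) F"
  show "\<forall>m. eventually (\<lambda>n. mfps_coeff (X n) m = mfps_coeff f m) F"
  proof
    fix m
    have "open {h. mfps_coeff h m = mfps_coeff f m}"
      unfolding open_mfps_def by (auto intro!: exI[of _ "{m}"])
    from topological_tendstoD[OF L this]
    show "eventually (\<lambda>n. mfps_coeff (X n) m = mfps_coeff f m) F" by simp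
  qed
next
  assume R: "\<forall>m. eventually (\<lambda>n. mfps_coeff (X n) m = mfps_coeff f m) F"
  show "(X \<longlongrightarrow> f) F"
  proof (rule topological_tendstoI)
    fix S assume "open S" "f \<in> S"
    then obtain A where A: "finite A" "\<And>g. (\<forall>m\<in>A. mfps_coeff g m = mfps_coeff f m) \<Longrightarrow> g \<in> S"
      unfolding open_mfps_def by meson
    have "eventually (\<lambda>n. \<forall>m\<in>A. mfps_coeff (X n) m = mfps_coeff f m) F"
      using A(1) R by (simp add: eventually_ball_finite)
    then show "eventually (\<lambda>n. X n \<in> S) F"
      by eventually_elim (rule A(2))
  qed
qed

lemma mfps_coeff_sum: "mfps_coeff (sum f A) m = (\<Sum>x\<in>A. mfps_coeff (f x) m)"
  for f :: "'i \<Rightarrow> ('v, 'a::comm_ring_1) mfps"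
  by (induction A rule: infinite_finite_induct) auto

lemma mfps_summableI:
  fixes f :: "nat \<Rightarrow> ('v, 'a::comm_ring_1) mfps"
  assumes "\<And>m. \<exists>N. \<forall>n\<ge>N. mfps_coeff (f n) m = 0"
  shows "summable f"
proof -
  from assms obtain N where N: "\<And>m n. n \<ge> N m \<Longrightarrow> mfps_coeff (f n) m = 0" by metis
  have "f sums Abs_mfps (\<lambda>m. \<Sum>n<N m. mfps_coeff (f n) m)"
    unfolding sums_def mfps_tendsto_iff eventually_sequentially
  proof (intro allI exI impI)
    fix m k assume "N m \<le> k"
    then show "mfps_coeff (sum f {..<k}) m =
        mfps_coeff (Abs_mfps (\<lambda>m. \<Sum>n<N m. mfps_coeff (f n) m)) m"
      by (simp add: mfps_coeff_sum) (rule sum.mono_neutral_right, auto intro: N)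
  qed
  then show ?thesis by (simp add: summable_def) blast
qed

text \<open>Meaningful only if the constant term of \<open>g\<close> vanishes, see \<open>summable_mfps_subst\<close> below.\<close>

definition mfps_subst :: "'a::comm_ring_1 fps \<Rightarrow> ('v, 'a) mfps \<Rightarrow> ('v, 'a) mfps" where
  "mfps_subst f g = (\<Sum>n. mfps_const (fps_nth f n) * g ^ n)"

definition mfps_exp :: "('v, 'a::field_char_0) mfps \<Rightarrow> ('v, 'a) mfps" where
  "mfps_exp g = mfps_subst (fps_exp 1) g"

lemma mfps_coeff_power_eq_0:
  fixes g :: "('v, 'a::comm_ring_1) mfps"
  assumes "mfps_coeff g {#} = 0" and "size m < n"
  shows "mfps_coeff (g ^ n) m = 0"
  using assms(2)
proof (induction n arbitrary: m)
  case 0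
  then show ?case by simp
next
  case (Suc n)
  have "mfps_coeff g a * mfps_coeff (g ^ n) b = 0" if "a + b = m" for a b
  proof (cases "a = {#}")
    case True
    then show ?thesis using assms(1) by simp
  next
    case False
    then have "size b < n" using that Suc.prems by (auto simp: nonempty_has_size)
    then show ?thesis using Suc.IH by simp
  qed
  then show ?case by (auto simp: mfps_coeff_mult msplits_def intro!: sum.neutral)
qed

lemma mfps_coeff_mult_eq_0:
  fixes f g :: "('v, 'a::comm_ring_1) mfps"
  assumes "\<And>a b. a + b = m \<Longrightarrow> mfps_coeff f a = 0 \<or> mfps_coeff g b = 0"
  shows "mfps_coeff (f * g) m = 0"
  unfolding mfps_coeff_mult using assms by (fastforce simp: msplits_def intro!: sum.neutral)

lemma mfps_coeff_const_mult_eq_0: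
  fixes f :: "('v, 'a::comm_ring_1) mfps"
  assumes "mfps_coeff f m = 0"
  shows "mfps_coeff (mfps_const c * f) m = 0"
  using assms by (intro mfps_coeff_mult_eq_0) (auto simp: mfps_const_def)

lemma summable_mfps_subst:
  fixes g :: "('v, 'a::comm_ring_1) mfps"
  assumes "mfps_coeff g {#} = 0"
  shows "summable (\<lambda>n. mfps_const (fps_nth f n) * g ^ n)"
proof (rule mfps_summableI)
  fix m
  show "\<exists>N. \<forall>n\<ge>N. mfps_coeff (mfps_const (fps_nth f n) * g ^ n) m = 0"
    by (rule exI[of _ "Suc (size m)"])
       (auto intro!: mfps_coeff_const_mult_eq_0 mfps_coeff_power_eq_0 assms)
qed

lemma summable_mfps_vars:
  "summable (\<lambda>j. mfps_const (c j) * mfps_var (Suc j) :: (nat, 'a::comm_ring_1) mfps)"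
proof (rule mfps_summableI)
  fix m :: "nat multiset"
  show "\<exists>N. \<forall>n\<ge>N. mfps_coeff (mfps_const (c n) * mfps_var (Suc n) :: (nat, 'a) mfps) m = 0"
    by (rule exI[of _ "sum_mset m"])
       (auto intro!: mfps_coeff_const_mult_eq_0 simp: mfps_var_def)
qed

text \<open>In particular, power series may be substituted at \<open>x\<^sub>1 + x\<^sub>2 / 2 + x\<^sub>3 / 3 + \<cdots>\<close>.\<close>

lemma mfps_coeff_vars_empty:
  "mfps_coeff (\<Sum>j. mfps_const (c j) * mfps_var (Suc j) :: (nat, 'a::comm_ring_1) mfps) {#} = 0"
proof -
  have "(\<lambda>j. mfps_const (c j) * mfps_var (Suc j) :: (nat, 'a) mfps) sums
          (\<Sum>j. mfps_const (c j) * mfps_var (Suc j))"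
    by (rule summable_sums[OF summable_mfps_vars])
  then have "\<forall>\<^sub>F n in sequentially.
      mfps_coeff (\<Sum>j<n. mfps_const (c j) * mfps_var (Suc j) :: (nat, 'a) mfps) {#} =
      mfps_coeff (\<Sum>j. mfps_const (c j) * mfps_var (Suc j)) {#}"
    unfolding sums_def mfps_tendsto_iff by blast
  moreover have "mfps_coeff (\<Sum>j<n. mfps_const (c j) * mfps_var (Suc j) :: (nat, 'a) mfps) {#} = 0" for n
    unfolding mfps_coeff_sum
    by (auto intro!: sum.neutral mfps_coeff_const_mult_eq_0 simp: mfps_var_def)
  ultimately show ?thesis
    by (auto simp: eventually_sequentially)
qed


section \<open>Species\<close>

text \<open>
  A species sends a finite set \<open>U\<close> to \<open>structures F U\<close> and a bijection \<open>\<sigma>\<close> from \<open>U\<close> onto \<open>\<sigma> ` U\<close>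
  to the function \<open>transport F U \<sigma>\<close>. The finite sets range over the finite subsets of a type \<open>'a\<close>.
\<close>

record ('a, 's) species =
  structures :: "'a set \<Rightarrow> 's set"
  transport :: "'a set \<Rightarrow> ('a \<Rightarrow> 'a) \<Rightarrow> 's \<Rightarrow> 's"

definition is_species :: "('a, 's) species \<Rightarrow> bool" where
  "is_species F \<longleftrightarrow>
     (\<forall>U. finite U \<longrightarrow> finite (structures F U)) \<and>
     (\<forall>U V \<sigma>. finite U \<and> bij_betw \<sigma> U V \<longrightarrow>
        (\<forall>s\<in>structures F U. transport F U \<sigma> s \<in> structures F V)) \<and>
     (\<forall>U \<sigma> \<tau>. finite U \<and> inj_on \<sigma> U \<and> (\<forall>x\<in>U. \<sigma> x = \<tau> x) \<longrightarrow>
        (\<forall>s\<in>structures F U. transport F U \<sigma> s = transport F U \<tau> s)) \<and>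
     (\<forall>U. finite U \<longrightarrow> (\<forall>s\<in>structures F U. transport F U id s = s)) \<and>
     (\<forall>U V W \<sigma> \<tau>. finite U \<and> bij_betw \<sigma> U V \<and> bij_betw \<tau> V W \<longrightarrow>
        (\<forall>s\<in>structures F U.
           transport F U (\<tau> \<circ> \<sigma>) s = transport F V \<tau> (transport F U \<sigma> s)))"

definition gen_series :: "(nat, 's) species \<Rightarrow> rat fps" where
  "gen_series F = Abs_fps (\<lambda>n. of_nat (card (structures F {1..n})) / fact n)"

definition iso_rel :: "(nat, 's) species \<Rightarrow> nat \<Rightarrow> 's rel" where
  "iso_rel F n = {(s, t). s \<in> structures F {1..n} \<and> t \<in> structures F {1..n} \<and>
     (\<exists>\<sigma>. \<sigma> permutes {1..n} \<and> transport F {1..n} \<sigma> s = t)}"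

definition type_gen_series :: "(nat, 's) species \<Rightarrow> rat fps" where
  "type_gen_series F = Abs_fps (\<lambda>n. of_nat (card (structures F {1..n} // iso_rel F n)))"

definition fix_count :: "(nat, 's) species \<Rightarrow> nat \<Rightarrow> (nat \<Rightarrow> nat) \<Rightarrow> nat" where
  "fix_count F n \<sigma> = card {s \<in> structures F {1..n}. transport F {1..n} \<sigma> s = s}"

text \<open>The number of cycles of length \<open>j\<close>; a fixed point is a cycle of length 1.\<close>

definition cycle_count :: "nat \<Rightarrow> (nat \<Rightarrow> nat) \<Rightarrow> nat \<Rightarrow> nat" where
  "cycle_count n \<sigma> j = card {C \<in> orbit \<sigma> ` {1..n}. card C = j}"

text \<open>
  The variable \<open>x\<^sub>j\<close> is \<open>mfps_var j\<close> for \<open>j \<ge> 1\<close>; \<open>mfps_var 0\<close> does not occur. A permutation of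
  \<open>{1..n}\<close> has no cycles longer than \<open>n\<close>, so the product may stop at \<open>n\<close>.
\<close>

definition cycle_index_term :: "(nat, 's) species \<Rightarrow> nat \<Rightarrow> (nat, rat) mfps" where
  "cycle_index_term F n =
     mfps_const (1 / fact n) *
     (\<Sum>\<sigma> | \<sigma> permutes {1..n}.
        of_nat (fix_count F n \<sigma>) * (\<Prod>j=1..n. mfps_var j ^ cycle_count n \<sigma> j))"

definition cycle_index :: "(nat, 's) species \<Rightarrow> (nat, rat) mfps" where
  "cycle_index F = (\<Sum>n. cycle_index_term F n)"

lemma equiv_iso_rel:
  assumes "is_species F"
  shows "equiv (structures F {1..n}) (iso_rel F n)"
proof -
  let ?U = "{1..n}"
  have id: "transport F ?U id s = s" if "s \<in> structures F ?U" for s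
    using assms that unfolding is_species_def by simp
  have comp: "transport F ?U (\<tau> \<circ> \<sigma>) s = transport F ?U \<tau> (transport F ?U \<sigma> s)"
    if "s \<in> structures F ?U" "\<sigma> permutes ?U" "\<tau> permutes ?U" for s \<sigma> \<tau>
  proof -
    have "\<forall>U V W \<sigma> \<tau>. finite U \<and> bij_betw \<sigma> U V \<and> bij_betw \<tau> V W \<longrightarrow>
        (\<forall>s\<in>structures F U.
           transport F U (\<tau> \<circ> \<sigma>) s = transport F V \<tau> (transport F U \<sigma> s))"
      using assms unfolding is_species_def by (elim conjE)
    then show ?thesis
      using that(1) permutes_imp_bij[OF that(2)] permutes_imp_bij[OF that(3)] by blast
  qed
  show ?thesis
  proof (rule equivI)
    show "iso_rel F n \<subseteq> structures F ?U \<times> structures F ?U"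
      by (auto simp: iso_rel_def)
    show "refl_on (structures F ?U) (iso_rel F n)"
    proof (rule refl_onI)
      fix s assume s: "s \<in> structures F ?U"
      then show "(s, s) \<in> iso_rel F n"
        unfolding iso_rel_def using id[OF s] permutes_id by blast
    qed
    show "sym (iso_rel F n)"
    proof (rule symI)
      fix s t assume "(s, t) \<in> iso_rel F n"
      then obtain \<sigma> where \<sigma>: "s \<in> structures F ?U" "t \<in> structures F ?U" "\<sigma> permutes ?U"
        "transport F ?U \<sigma> s = t" by (auto simp: iso_rel_def)
      have "transport F ?U (inv \<sigma>) t = s"
        using comp[OF \<sigma>(1) \<sigma>(3) permutes_inv[OF \<sigma>(3)]] \<sigma> id
        by (simp add: permutes_inv_o)
      then show "(t, s) \<in> iso_rel F n"
        using \<sigma> permutes_inv by (auto simp: iso_rel_def)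
    qed
    show "trans (iso_rel F n)"
    proof (rule transI)
      fix s t u assume "(s, t) \<in> iso_rel F n" "(t, u) \<in> iso_rel F n"
      then obtain \<sigma> \<tau> where *: "s \<in> structures F ?U" "u \<in> structures F ?U"
        "\<sigma> permutes ?U" "\<tau> permutes ?U"
        "transport F ?U \<sigma> s = t" "transport F ?U \<tau> t = u" by (auto simp: iso_rel_def)
      then have "transport F ?U (\<tau> \<circ> \<sigma>) s = u" by (simp only: comp)
      then show "(s, u) \<in> iso_rel F n"
        unfolding iso_rel_def using * permutes_compose by blast
    qed
  qed
qed

lemma sum_cycle_count:
  assumes "\<sigma> permutes {1..n}"
  shows "(\<Sum>j=1..n. j * cycle_count n \<sigma> j) = n"
proof -
  let ?O = "orbit \<sigma> ` {1..n}"
  have perm: "permutation \<sigma>"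
    using assms permutation_permutes by blast
  have self: "x \<in> orbit \<sigma> x" for x
    by (rule permutation_self_in_orbit[OF perm])
  have sub: "orbit \<sigma> x \<subseteq> {1..n}" if "x \<in> {1..n}" for x
    using permutes_orbit_subset[OF assms that] .
  have eq: "orbit \<sigma> x = orbit \<sigma> y" if "z \<in> orbit \<sigma> x" "z \<in> orbit \<sigma> y" for x y z
    using that cyclic_on_orbit'[OF perm] unfolding cyclic_on_alldef by metis
  have un: "\<Union>?O = {1..n}"
    using self sub by blast
  have "n = card (\<Union>?O)"
    using un by simp
  also have "\<dots> = (\<Sum>C\<in>?O. card C)"
  proof (rule card_Union_disjoint)
    show "pairwise disjnt ?O"
      unfolding pairwise_def disjnt_def using eq by blast
    show "finite C" if "C \<in> ?O" for C
      using that sub finite_subset by (metis finite_atLeastAtMost imageE)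
  qed
  also have "\<dots> = (\<Sum>j\<in>{1..n}. \<Sum>C\<in>{C\<in>?O. card C = j}. card C)"
  proof (rule sum.group[symmetric])
    show "card ` ?O \<subseteq> {1..n}"
    proof safe
      fix x assume x: "x \<in> {1..n}"
      have "card (orbit \<sigma> x) \<le> n"
        using card_mono[OF _ sub[OF x]] by simp
      moreover have "card (orbit \<sigma> x) > 0"
        using self[of x] finite_subset[OF sub[OF x]] by (auto simp: card_gt_0_iff)
      ultimately show "card (orbit \<sigma> x) \<in> {1..n}" by simp
    qed
  qed auto
  also have "\<dots> = (\<Sum>j=1..n. j * cycle_count n \<sigma> j)"
    by (rule sum.cong) (auto simp: cycle_count_def mult.commute)
  finally show ?thesis ..
qed

lemma mfps_coeff_of_nat_mult_eq_0:
  fixes f :: "('v, 'a::comm_ring_1) mfps"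
  shows "mfps_coeff f m = 0 \<Longrightarrow> mfps_coeff (of_nat k * f) m = 0"
  by (induction k) (auto simp: distrib_right)

lemma mfps_coeff_var_power:
  "mfps_coeff (mfps_var v ^ k :: ('v, 'a::comm_ring_1) mfps) m \<noteq> 0 \<Longrightarrow> m = replicate_mset k v"
proof (induction k arbitrary: m)
  case 0
  then show ?case by (simp split: if_splits)
next
  case (Suc k)
  have coeff_var: "mfps_coeff (mfps_var v :: ('v, 'a) mfps) a = (if a = {#v#} then 1 else 0)" for a
    by (simp add: mfps_var_def)
  show ?case
  proof (rule ccontr)
    assume m: "m \<noteq> replicate_mset (Suc k) v"
    have "mfps_coeff (mfps_var v * mfps_var v ^ k :: ('v, 'a) mfps) m = 0"
    proof (rule mfps_coeff_mult_eq_0)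
      fix a b assume "a + b = m"
      then show "mfps_coeff (mfps_var v :: ('v, 'a) mfps) a = 0 \<or>
                 mfps_coeff (mfps_var v ^ k :: ('v, 'a) mfps) b = 0"
        using m Suc.IH[of b] by (cases "a = {#v#}") (auto simp: coeff_var)
    qed
    with Suc.prems show False by simp
  qed
qed

lemma mfps_coeff_var_prod:
  assumes "finite A"
  shows "mfps_coeff (\<Prod>j\<in>A. mfps_var j ^ c j :: (nat, 'a::comm_ring_1) mfps) m \<noteq> 0 \<Longrightarrow>
    sum_mset m = (\<Sum>j\<in>A. j * c j)"
  using assms
proof (induction A arbitrary: m rule: finite_induct)
  case empty
  then show ?case by (simp split: if_splits)
next
  case (insert x A)
  then obtain a b where ab: "a + b = m"
    "mfps_coeff (mfps_var x ^ c x :: (nat, 'a) mfps) a \<noteq> 0"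
    "mfps_coeff (\<Prod>j\<in>A. mfps_var j ^ c j :: (nat, 'a) mfps) b \<noteq> 0"
    using mfps_coeff_mult_eq_0[of m "mfps_var x ^ c x :: (nat, 'a) mfps"
      "\<Prod>j\<in>A. mfps_var j ^ c j :: (nat, 'a) mfps"] by auto
  then show ?case
    using mfps_coeff_var_power[OF ab(2)] insert by (auto simp: mult.commute)
qed

lemma summable_cycle_index: "summable (cycle_index_term F)"
proof (rule mfps_summableI)
  fix m :: "nat multiset"
  have "mfps_coeff (\<Prod>j=1..n. mfps_var j ^ cycle_count n \<sigma> j :: (nat, rat) mfps) m = 0"
    if "n > sum_mset m" "\<sigma> permutes {1..n}" for n \<sigma>
    using mfps_coeff_var_prod[of "{1..n}" "cycle_count n \<sigma>" m] sum_cycle_count[OF that(2)] that(1)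
    by fastforce
  then show "\<exists>N. \<forall>n\<ge>N. mfps_coeff (cycle_index_term F n) m = 0"
    by (intro exI[of _ "Suc (sum_mset m)"])
       (auto simp: cycle_index_term_def mfps_coeff_sum
         intro!: mfps_coeff_const_mult_eq_0 sum.neutral mfps_coeff_of_nat_mult_eq_0)
qed


section \<open>Interval orders\<close>

definition transport_rel :: "('a \<Rightarrow> 'b) \<Rightarrow> 'a rel \<Rightarrow> 'b rel" where
  "transport_rel \<sigma> P = {(\<sigma> x, \<sigma> y) |x y. (x, y) \<in> P}"

text \<open>The disjoint union of two two-element chains, on the ground set \<open>{0, 1, 2, 3}\<close>.\<close>

definition two_plus_two :: "nat rel" where
  "two_plus_two = {(0, 1), (2, 3)}"

definition interval_orders :: "'a set \<Rightarrow> 'a rel set" where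
  "interval_orders U = {P. P \<subseteq> U \<times> U \<and> irrefl P \<and> trans P \<and>
     \<not> (\<exists>S f. S \<subseteq> U \<and> bij_betw f {0, 1, 2, 3} S \<and>
            transport_rel f two_plus_two = P \<inter> S \<times> S)}"

definition interval_order_species :: "('a, 'a rel) species" where
  "interval_order_species = \<lparr>structures = interval_orders, transport = (\<lambda>U. transport_rel)\<rparr>"

lemma transport_rel_comp: "transport_rel (g \<circ> f) P = transport_rel g (transport_rel f P)"
  by (auto simp: transport_rel_def)

lemma transport_rel_cong:
  "P \<subseteq> U \<times> U \<Longrightarrow> (\<And>x. x \<in> U \<Longrightarrow> f x = g x) \<Longrightarrow> transport_rel f P = transport_rel g P"
  unfolding transport_rel_def by (intro Collect_cong) (metis SigmaD1 SigmaD2 subsetD)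

lemma transport_interval_orders:
  assumes \<sigma>: "bij_betw \<sigma> U V" and P: "P \<in> interval_orders U"
  shows "transport_rel \<sigma> P \<in> interval_orders V"
proof -
  have inj: "\<And>x y. x \<in> U \<Longrightarrow> y \<in> U \<Longrightarrow> \<sigma> x = \<sigma> y \<longleftrightarrow> x = y"
    using \<sigma> by (auto simp: bij_betw_def inj_on_def)
  have PU: "P \<subseteq> U \<times> U" and irr: "irrefl P" and tr: "trans P"
    using P by (auto simp: interval_orders_def)
  have "False" if S: "S \<subseteq> V" "bij_betw f {0, 1, 2, 3} S"
    "transport_rel f two_plus_two = transport_rel \<sigma> P \<inter> S \<times> S" for S f
  proof -
    let ?\<tau> = "inv_into U \<sigma>"
    have \<tau>: "bij_betw ?\<tau> V U" by (rule bij_betw_inv_into[OF \<sigma>])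
    have \<tau>\<sigma>: "?\<tau> (\<sigma> x) = x" if "x \<in> U" for x
      using that \<sigma> by (simp add: bij_betw_inv_into_left)
    have \<sigma>\<tau>: "\<sigma> (?\<tau> y) = y" if "y \<in> V" for y
      using that \<sigma> by (simp add: bij_betw_inv_into_right)
    have "?\<tau> ` S \<subseteq> U" using \<tau> S(1) by (auto simp: bij_betw_def)
    moreover have "bij_betw (?\<tau> \<circ> f) {0, 1, 2, 3} (?\<tau> ` S)"
      using bij_betw_trans[OF S(2) bij_betw_subset[OF \<tau> S(1) refl]] .
    moreover have "transport_rel (?\<tau> \<circ> f) two_plus_two = P \<inter> (?\<tau> ` S) \<times> (?\<tau> ` S)"
    proof -
      have "transport_rel ?\<tau> (transport_rel \<sigma> P \<inter> S \<times> S) = P \<inter> (?\<tau> ` S) \<times> (?\<tau> ` S)"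
      proof (intro equalityI subsetI)
        fix z assume "z \<in> transport_rel ?\<tau> (transport_rel \<sigma> P \<inter> S \<times> S)"
        then obtain x y where "(x, y) \<in> P" "\<sigma> x \<in> S" "\<sigma> y \<in> S" "z = (?\<tau> (\<sigma> x), ?\<tau> (\<sigma> y))"
          by (auto simp: transport_rel_def)
        moreover from this have "x \<in> U" "y \<in> U" using PU by auto
        ultimately show "z \<in> P \<inter> (?\<tau> ` S) \<times> (?\<tau> ` S)"
          using \<tau>\<sigma>[of x] \<tau>\<sigma>[of y] by (metis IntI SigmaI imageI)
      next
        fix z assume "z \<in> P \<inter> (?\<tau> ` S) \<times> (?\<tau> ` S)"
        then obtain x y where z: "z = (?\<tau> x, ?\<tau> y)" "x \<in> S" "y \<in> S" "(?\<tau> x, ?\<tau> y) \<in> P"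
          by auto
        then have "(x, y) \<in> transport_rel \<sigma> P"
          using \<sigma>\<tau> S(1) unfolding transport_rel_def by force
        then show "z \<in> transport_rel ?\<tau> (transport_rel \<sigma> P \<inter> S \<times> S)"
          using z by (auto simp: transport_rel_def)
      qed
      then show ?thesis by (simp add: transport_rel_comp S(3))
    qed
    ultimately show False using P unfolding interval_orders_def by blast
  qed
  moreover have "transport_rel \<sigma> P \<subseteq> V \<times> V"
    using PU \<sigma> by (auto simp: transport_rel_def bij_betw_def)
  moreover have "irrefl (transport_rel \<sigma> P)"
    using irr PU inj unfolding irrefl_def transport_rel_def by fastforce
  moreover have "trans (transport_rel \<sigma> P)"
  proof (rule transI)
    fix a b c assume "(a, b) \<in> transport_rel \<sigma> P" "(b, c) \<in> transport_rel \<sigma> P"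
    then obtain x y y' z where *: "(x, y) \<in> P" "(y', z) \<in> P" "a = \<sigma> x" "b = \<sigma> y" "b = \<sigma> y'" "c = \<sigma> z"
      by (auto simp: transport_rel_def)
    then have "y = y'" using inj PU by auto
    then have "(x, z) \<in> P" using * tr by (meson transD)
    then show "(a, c) \<in> transport_rel \<sigma> P" using * by (auto simp: transport_rel_def)
  qed
  ultimately show ?thesis unfolding interval_orders_def by blast
qed

lemma is_species_interval_order_species: "is_species interval_order_species"
proof -
  have sub: "P \<subseteq> U \<times> U" if "P \<in> interval_orders U" for P and U :: "'a set"
    using that by (auto simp: interval_orders_def)
  have fin: "finite (interval_orders U)" if "finite U" for U :: "'a set"
    by (rule finite_subset[of _ "Pow (U \<times> U)"]) (use that sub in auto)
  have id: "transport_rel id P = P" for P :: "'a rel"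
    by (auto simp: transport_rel_def)
  have cong: "transport_rel \<sigma> P = transport_rel \<tau> P"
    if "P \<in> interval_orders U" "\<forall>x\<in>U. \<sigma> x = \<tau> x" for P U and \<sigma> \<tau> :: "'a \<Rightarrow> 'a"
    by (rule transport_rel_cong[OF sub]) (use that in auto)
  show ?thesis
    unfolding is_species_def interval_order_species_def species.simps
  proof (intro conjI allI impI ballI)
    fix U V :: "'a set" and \<sigma> s
    assume "finite U \<and> bij_betw \<sigma> U V" "s \<in> interval_orders U"
    then show "transport_rel \<sigma> s \<in> interval_orders V"
      using transport_interval_orders by blast
  next
    fix U :: "'a set" and \<sigma> \<tau> :: "'a \<Rightarrow> 'a" and s
    assume "finite U \<and> inj_on \<sigma> U \<and> (\<forall>x\<in>U. \<sigma> x = \<tau> x)" "s \<in> interval_orders U"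
    then show "transport_rel \<sigma> s = transport_rel \<tau> s"
      by (intro cong) auto
  qed (simp_all only: fin id transport_rel_comp)
qed

end

theory Submission
  imports Defs
begin

unbundle fps_syntax

text \<open>
  In an interval order the sets of predecessors form a chain, say with \<open>k\<close>
  members. Recording for every element the position of its predecessor set in the chain and the number of members of
  the chain that contain it puts the elements into the cells of a triangular \<open>k \<times> k\<close> matrix
  without empty rows and columns, and this is a bijection
  (\<open>level_labels_order_of\<close>, \<open>level_labels_representation\<close>). Inclusion-exclusion over the empty columns
  \<open>S\<close> gives the exponential generating function
  \<open>\<Sum>\<^sub>S (-1)\<^bsup>|S|\<^esup> \<Prod>\<^sub>i (e\<^bsup>c(i) x\<^esup> - 1)\<close>, where \<open>c(i)\<close> is the number of columns up to \<open>i\<close> outside \<open>S\<close>. Read as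
  a sum over walks, where every step either raises the height \<open>c\<close> by one or keeps it, the sum over all \<open>k\<close> is easy: the
  steps that keep the height at \<open>c\<close> form a geometric series with sum \<open>e\<^bsup>-c x\<^esup>\<close>, so reaching the height
  \<open>m\<close> has the total weight \<open>\<Prod>\<^sub>c (e\<^bsup>c x\<^esup> - 1) e\<^bsup>-c x\<^esup> = \<Prod>\<^sub>c (1 - e\<^bsup>-c x\<^esup>)\<close>, with \<open>c\<close> from \<open>1\<close> to \<open>m\<close>
  (\<open>sum_walk_weight_nth\<close>, \<open>card_interval_orders\<close>).

  An automorphism preserves the sizes of predecessor sets, hence, by the chain property, the sets
  themselves, and likewise for successors. So the interval orders fixed by a permutation \<open>\<sigma>\<close> correspond to
  the interval orders on the set of cycles of \<open>\<sigma>\<close> (\<open>card_fixed_interval_orders\<close>), and there are as many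
  of them as labeled interval orders on \<open>c\<close> points, where \<open>c\<close> is the number of cycles of \<open>\<sigma>\<close>.

  Since \<open>q\<^sup>c / c!\<close> is the cycle index series of the sets of \<open>c\<close> cycles
  (\<open>card_permutations_of_cycle_type\<close>, \<open>mfps_coeff_cycle_var_power\<close>), the previous remark says that the cycle index series
  is the generating series with \<open>q\<close> substituted for \<open>x\<close>. Substitution is a continuous ring homomorphism, so
  the sum of products carries over.

  By the orbit-counting lemma (\<open>type_gen_series_nth\<close>) the coefficients of the type generating series
  are averages over permutations, and the generating function of the permutations by number of
  cycles (\<open>sum_power_cycle_number\<close>) shows that the average turns \<open>e\<^bsup>-j x\<^esup>\<close> into \<open>(1 - x)\<^sup>j\<close>.
\<close>

section \<open>The canonical representation of an interval order\<close>

lemma transport_two_plus_two: "transport_rel f two_plus_two = {(f 0, f 1), (f 2, f 3)}"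
  unfolding transport_rel_def two_plus_two_def by blast

text \<open>
  This Ferrers-type condition is the form of \<open>(2+2)\<close>-freeness that all arguments below use: if neither of the
  two exchanged pairs were in \<open>P\<close>, then irreflexivity and transitivity would make \<open>x, y, z, w\<close>
  distinct and exclude every further relation between them. Transitivity is the case \<open>y = z\<close>.
\<close>

lemma interval_orders_iff:
  "P \<in> interval_orders U \<longleftrightarrow> P \<subseteq> U \<times> U \<and> irrefl P \<and>
     (\<forall>x y z w. (x, y) \<in> P \<longrightarrow> (z, w) \<in> P \<longrightarrow> (x, w) \<in> P \<or> (z, y) \<in> P)"
  (is "_ \<longleftrightarrow> ?R")
proof
  assume P: "P \<in> interval_orders U"
  then have sub: "P \<subseteq> U \<times> U" and irr: "irrefl P" and tr: "trans P"
    and free: "\<And>S f. S \<subseteq> U \<Longrightarrow> bij_betw f {0, 1, 2, 3} S \<Longrightarrow>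
          transport_rel f two_plus_two \<noteq> P \<inter> S \<times> S"
    by (auto simp: interval_orders_def)
  have irr': "(x, x) \<notin> P" for x using irr by (auto simp: irrefl_def)
  have "(x, w) \<in> P \<or> (z, y) \<in> P" if xy: "(x, y) \<in> P" and zw: "(z, w) \<in> P" for x y z w
  proof (rule ccontr)
    assume neg: "\<not> ?thesis"
    define f :: "nat \<Rightarrow> 'a" where "f = (\<lambda>_. w)(0 := x, 1 := y, 2 := z)"
    let ?S = "{x, y, z, w}"
    have tr': "\<And>a b c. (a, b) \<in> P \<Longrightarrow> (b, c) \<in> P \<Longrightarrow> (a, c) \<in> P"
      using tr by (meson transD)
    have no: "(x, w) \<notin> P" "(z, y) \<notin> P" using neg by auto
    have ne: "x \<noteq> y" "z \<noteq> w" "x \<noteq> z" "x \<noteq> w" "y \<noteq> z" "y \<noteq> w"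
      using irr' xy zw no tr'[of x y w] tr'[of z w y] by auto
    have "bij_betw f {0, 1, 2, 3} ?S"
      unfolding bij_betw_def inj_on_def f_def using ne by auto
    moreover have "?S \<subseteq> U" using sub xy zw by auto
    moreover have "transport_rel f two_plus_two = P \<inter> ?S \<times> ?S"
    proof -
      have "transport_rel f two_plus_two = {(x, y), (z, w)}"
        by (simp add: transport_two_plus_two f_def)
      moreover have "(x, z) \<notin> P" "(x, w) \<notin> P" "(y, z) \<notin> P" "(y, w) \<notin> P" "(y, x) \<notin> P" "(w, z) \<notin> P"
        "(z, x) \<notin> P" "(z, y) \<notin> P" "(w, x) \<notin> P" "(w, y) \<notin> P"
        using no irr' xy zw tr'[of x z w] tr'[of y z w] tr'[of x y w] tr'[of x y x] tr'[of z w z]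
          tr'[of x w z] tr'[of z x y] tr'[of w x y] tr'[of z w y] tr'[of z y x] tr'[of y w y] tr'[of w y x]
          tr'[of y z y] tr'[of x w x] by metis+
      ultimately show ?thesis using xy zw irr' by auto
    qed
    ultimately show False using free by blast
  qed
  with sub irr show ?R by blast
next
  assume R: ?R
  then have irr: "(x, x) \<notin> P" for x by (auto simp: irrefl_def)
  have "trans P" using R irr by (meson transI)
  moreover have False
    if S: "bij_betw f {0, 1, 2, 3} S" "transport_rel f two_plus_two = P \<inter> S \<times> S" for S and f :: "nat \<Rightarrow> 'a"
  proof -
    have eq: "P \<inter> S \<times> S = {(f 0, f 1), (f 2, f 3)}"
      by (simp add: S(2)[symmetric] transport_two_plus_two)
    have inS: "f 0 \<in> S" "f 1 \<in> S" "f 2 \<in> S" "f 3 \<in> S"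
      using S(1) by (auto simp: bij_betw_def)
    from eq have "(f 0, f 1) \<in> P" "(f 2, f 3) \<in> P" by blast+
    then have "(f 0, f 3) \<in> P \<inter> S \<times> S \<or> (f 2, f 1) \<in> P \<inter> S \<times> S"
      using R inS by blast
    then have "f 1 = f 3 \<or> f 0 = f 2" unfolding eq by auto
    then show False using S(1) by (auto simp: bij_betw_def inj_on_def)
  qed
  ultimately show "P \<in> interval_orders U"
    using R unfolding interval_orders_def by blast
qed

definition cells :: "nat \<Rightarrow> (nat \<times> nat) set" where
  "cells k = {(i, j). j \<le> i \<and> i < k}"

text \<open>
  A labelling \<open>h\<close> puts the elements of \<open>U\<close> into the cells of a triangular matrix; that both
  coordinates are onto says that the matrix has no empty row and no empty column. These are the
  Fishburn matrices with sets as entries. The functions are extensional so that a labelling of \<open>U\<close>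
  is determined by its values on \<open>U\<close>.
\<close>

definition representations :: "'a set \<Rightarrow> nat \<Rightarrow> ('a \<Rightarrow> nat \<times> nat) set" where
  "representations U k =
     {h \<in> U \<rightarrow>\<^sub>E cells k. (fst \<circ> h) ` U = {..<k} \<and> (snd \<circ> h) ` U = {..<k}}"

text \<open>
  If \<open>h x = (i, j)\<close>, then \<open>x\<close> is represented by the interval from \<open>k - i\<close> to \<open>k - j\<close>, and \<open>x\<close> precedes
  \<open>y\<close> if the interval of \<open>x\<close> lies entirely to the left of the interval of \<open>y\<close>. Counting from the
  right makes the last row of the matrix the one to add when \<open>k\<close> grows to \<open>Suc k\<close>.
\<close>

definition order_of :: "'a set \<Rightarrow> ('a \<Rightarrow> nat \<times> nat) \<Rightarrow> 'a rel" where
  "order_of U h = {(x, y) \<in> U \<times> U. fst (h y) < snd (h x)}"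

definition preds :: "'a rel \<Rightarrow> 'a \<Rightarrow> 'a set" where
  "preds P x = {y. (y, x) \<in> P}"

text \<open>
  The inverse of \<open>order_of\<close>. As the predecessor sets of an interval order form a chain, counting the members above
  the predecessor set of \<open>x\<close> determines that set, and counting the members that contain \<open>x\<close> determines
  to which of them \<open>x\<close> belongs.
\<close>

definition level_labels :: "'a set \<Rightarrow> 'a rel \<Rightarrow> 'a \<Rightarrow> nat \<times> nat" where
  "level_labels U P = (\<lambda>x\<in>U. (card {D \<in> preds P ` U. preds P x \<subset> D}, card {D \<in> preds P ` U. x \<in> D}))"

lemma finite_cells [simp]: "finite (cells k)"
  by (rule finite_subset[of _ "{..<k} \<times> {..<k}"]) (auto simp: cells_def)

lemma order_of_interval_order:
  assumes h: "h \<in> representations U k"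
  shows "order_of U h \<in> interval_orders U"
proof -
  have "snd (h x) \<le> fst (h x)" if "x \<in> U" for x
    using h that by (fastforce simp: representations_def cells_def dest: PiE_mem)
  then show ?thesis
    unfolding interval_orders_iff order_of_def irrefl_def by fastforce
qed

text \<open>
  The predecessor sets of \<open>order_of U h\<close> are the levels \<open>{y \<in> U. i < snd (h y)}\<close>, which shrink strictly as
  \<open>i\<close> grows because the second coordinate is onto, and all of which occur because the first one is. Hence the
  positions in the chain give \<open>h\<close> back.
\<close>

lemma level_labels_order_of:
  assumes h: "h \<in> representations U k"
  shows "card (preds (order_of U h) ` U) = k" and "level_labels U (order_of U h) = h"
proof -
  define level where "level i = {y \<in> U. i < snd (h y)}" for i
  have onto: "fst ` h ` U = {..<k}" "snd ` h ` U = {..<k}" and ext: "h \<in> extensional U"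
    and ran: "\<And>x. x \<in> U \<Longrightarrow> fst (h x) < k \<and> snd (h x) < k"
    using h by (auto simp: representations_def cells_def PiE_def image_comp Pi_def split: prod.splits)
  have preds: "preds (order_of U h) x = level (fst (h x))" if "x \<in> U" for x
    using that by (auto simp: preds_def order_of_def level_def)
  have sub: "level i \<subset> level j \<longleftrightarrow> j < i" if "i < k" "j < k" for i j
  proof
    assume less: "level i \<subset> level j"
    show "j < i"
    proof (rule ccontr)
      assume "\<not> j < i"
      then have "level j \<subseteq> level i" by (auto simp: level_def)
      with less show False by blast
    qed
  next
    assume "j < i"
    obtain y where "y \<in> U" "snd (h y) = i" using onto(2) \<open>i < k\<close> by (metis (no_types, lifting) imageE lessThan_iff)
    then have "y \<in> level j - level i" using \<open>j < i\<close> by (auto simp: level_def)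
    moreover have "level i \<subseteq> level j" using \<open>j < i\<close> by (auto simp: level_def)
    ultimately show "level i \<subset> level j" by blast
  qed
  have inj: "inj_on level {..<k}"
    by (intro inj_onI) (metis lessThan_iff linorder_neqE_nat psubset_eq sub)
  have sets: "preds (order_of U h) ` U = level ` {..<k}"
    unfolding onto(1)[symmetric] image_image using preds by auto
  show "card (preds (order_of U h) ` U) = k"
    unfolding sets using card_image[OF inj] by simp
  have *: "card {D \<in> level ` {..<k}. Q D} = card {i \<in> {..<k}. Q (level i)}" for Q
  proof -
    have "{D \<in> level ` {..<k}. Q D} = level ` {i \<in> {..<k}. Q (level i)}" by auto
    moreover have "inj_on level {i \<in> {..<k}. Q (level i)}" by (rule inj_on_subset[OF inj]) auto
    ultimately show ?thesis by (simp only: card_image)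
  qed
  show "level_labels U (order_of U h) = h"
  proof (rule extensionalityI[OF _ ext])
    show "level_labels U (order_of U h) \<in> extensional U" by (simp add: level_labels_def)
  next
    fix x assume x: "x \<in> U"
    have "i < k \<and> level (fst (h x)) \<subset> level i \<longleftrightarrow> i < fst (h x)" for i
      using sub[of "fst (h x)" i] ran[OF x] by (cases "i < k") simp_all
    then have "{i \<in> {..<k}. level (fst (h x)) \<subset> level i} = {..<fst (h x)}"
      by (simp add: set_eq_iff)
    moreover have "{i \<in> {..<k}. x \<in> level i} = {..<snd (h x)}"
      using ran[OF x] x by (auto simp: level_def)
    moreover have "level_labels U (order_of U h) x =
        (card {D \<in> level ` {..<k}. level (fst (h x)) \<subset> D}, card {D \<in> level ` {..<k}. x \<in> D})"
      unfolding level_labels_def sets using x by (simp add: preds)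
    ultimately show "level_labels U (order_of U h) x = h x"
      unfolding * by (simp add: prod_eq_iff)
  qed
qed

lemma preds_chain:
  assumes P: "P \<in> interval_orders U"
  shows "preds P x \<subseteq> preds P y \<or> preds P y \<subseteq> preds P x"
  using P unfolding interval_orders_iff preds_def by blast

lemma chain_rank_image:
  assumes fin: "finite C" and chain: "\<And>A B. A \<in> C \<Longrightarrow> B \<in> C \<Longrightarrow> A \<subseteq> B \<or> B \<subseteq> A"
  shows "bij_betw (\<lambda>A. card {B \<in> C. A \<subset> B}) C {..<card C}"
proof -
  let ?r = "\<lambda>A. card {B \<in> C. A \<subset> B}"
  have less: "?r B < ?r A" if "A \<in> C" "B \<in> C" "A \<subset> B" for A B
  proof (rule psubset_card_mono)
    show "finite {B \<in> C. A \<subset> B}" using fin by simp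
    show "{D \<in> C. B \<subset> D} \<subset> {D \<in> C. A \<subset> D}" using that by blast
  qed
  have inj: "inj_on ?r C"
  proof (rule inj_onI, rule ccontr)
    fix A B assume *: "A \<in> C" "B \<in> C" "?r A = ?r B" "A \<noteq> B"
    then have "A \<subset> B \<or> B \<subset> A" using chain[of A B] by blast
    then show False using less[of A B] less[of B A] * by auto
  qed
  have "?r A < card C" if "A \<in> C" for A
    by (rule psubset_card_mono[OF fin]) (use that in blast)
  then have "?r ` C \<subseteq> {..<card C}" by auto
  then have "?r ` C = {..<card C}"
    by (intro card_subset_eq) (auto simp: card_image[OF inj])
  with inj show ?thesis by (simp add: bij_betw_def)
qed

text \<open>
  The heart of the matter is that \<open>y\<close> lies in the predecessor set of \<open>x\<close> iff more members of the chain
  contain \<open>y\<close> than lie strictly above that set. The second coordinate is onto because consecutive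
  members of the chain differ, and a point of the difference has the desired label.
\<close>

lemma level_labels_representation:
  assumes fin: "finite U" and P: "P \<in> interval_orders U"
  shows "level_labels U P \<in> representations U (card (preds P ` U))" and "order_of U (level_labels U P) = P"
proof -
  define C where "C = preds P ` U"
  define a b where "a x = card {D \<in> C. preds P x \<subset> D}" and "b x = card {D \<in> C. x \<in> D}" for x
  have finC: "finite C" using fin by (simp add: C_def)
  have chain: "A \<subseteq> B \<or> B \<subseteq> A" if "A \<in> C" "B \<in> C" for A B
    using that preds_chain[OF P] by (auto simp: C_def)
  have sub: "P \<subseteq> U \<times> U" and irr: "(x, x) \<notin> P" for x
    using P by (auto simp: interval_orders_iff irrefl_def)
  have rank: "bij_betw (\<lambda>A. card {B \<in> C. A \<subset> B}) C {..<card C}"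
    by (rule chain_rank_image[OF finC chain])
  have key: "preds P x \<in> C" if "x \<in> U" for x using that by (simp add: C_def)
  \<comment> \<open>The members of the chain containing a point form an upper segment.\<close>
  have up: "{D \<in> C. y \<in> D} \<subseteq> {D \<in> C. preds P x \<subset> D} \<longleftrightarrow> y \<notin> preds P x" if "x \<in> U" for x y
    using chain key[OF that] by blast
  have ba: "a x < b y \<longleftrightarrow> y \<in> preds P x" if "x \<in> U" for x y
  proof (cases "y \<in> preds P x")
    case True
    then have "{D \<in> C. preds P x \<subset> D} \<subset> {D \<in> C. y \<in> D}" using key[OF that] by blast
    then show ?thesis using True finC by (simp add: a_def b_def psubset_card_mono)
  next
    case False
    then have "b y \<le> a x" unfolding a_def b_def
      using up[OF that] finC by (intro card_mono) auto
    with False show ?thesis by simp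
  qed
  have canon: "level_labels U P x = (a x, b x)" if "x \<in> U" for x
    using that by (simp add: level_labels_def a_def b_def C_def)
  have aC: "a ` U = {..<card C}"
    using rank by (simp add: a_def C_def bij_betw_def image_image)
  have le: "b x \<le> a x" if "x \<in> U" for x
    using ba[OF that, of x] irr by (simp add: preds_def)
  have bC: "b ` U = {..<card C}"
  proof (intro equalityI subsetI)
    fix i assume "i \<in> b ` U"
    then obtain x where x: "x \<in> U" "i = b x" by blast
    then have "a x < card C" using aC by blast
    with le[of x] x show "i \<in> {..<card C}" by simp
  next
    fix i assume i: "i \<in> {..<card C}"
    then obtain x where x: "x \<in> U" "a x = i" using aC by (metis imageE)
    show "i \<in> b ` U"
    proof (cases i)
      case 0
      with le[OF x(1)] x show ?thesis by (auto intro!: image_eqI[of _ _ x])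
    next
      case (Suc j)
      then obtain z where z: "z \<in> U" "a z = j" using aC i by (metis imageE lessThan_iff Suc_lessD)
      \<comment> \<open>A predecessor of \<open>z\<close> that is not one of \<open>x\<close> has label \<open>j + 1\<close>, as the two sets are neighbours.\<close>
      have "\<not> preds P z \<subseteq> preds P x"
      proof
        assume "preds P z \<subseteq> preds P x"
        then have "{D \<in> C. preds P x \<subset> D} \<subseteq> {D \<in> C. preds P z \<subset> D}" by blast
        then have "a x \<le> a z" unfolding a_def using finC by (intro card_mono) auto
        then show False using x z Suc by simp
      qed
      then obtain y where y: "y \<in> preds P z" "y \<notin> preds P x" by blast
      then have "b y = i" using ba[OF x(1), of y] ba[OF z(1), of y] x z Suc by simp
      moreover have "y \<in> U" using y(1) sub by (auto simp: preds_def)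
      ultimately show ?thesis by blast
    qed
  qed
  have img: "(fst \<circ> level_labels U P) ` U = a ` U" "(snd \<circ> level_labels U P) ` U = b ` U"
    using canon by (auto intro!: image_cong)
  have "level_labels U P \<in> U \<rightarrow>\<^sub>E cells (card C)"
  proof (rule PiE_I)
    fix x assume "x \<in> U"
    then show "level_labels U P x \<in> cells (card C)" using canon le aC by (auto simp: cells_def)
  qed (simp add: level_labels_def)
  then show "level_labels U P \<in> representations U (card (preds P ` U))"
    unfolding representations_def using img aC bC by (simp add: C_def)
  show "order_of U (level_labels U P) = P"
    unfolding order_of_def using canon ba sub by (auto simp: preds_def)
qed

lemma card_interval_orders_eq_sum:
  assumes fin: "finite U"
  shows "card (interval_orders U) = (\<Sum>k\<le>card U. card (representations U k))"
proof -
  have bij: "bij_betw (order_of U) (\<Union>k\<le>card U. representations U k) (interval_orders U)"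
  proof (rule bij_betw_byWitness[where f' = "level_labels U"])
    have "card (preds P ` U) \<le> card U" for P :: "'a rel" using fin by (rule card_image_le)
    then show "level_labels U ` interval_orders U \<subseteq> (\<Union>k\<le>card U. representations U k)"
      using level_labels_representation(1)[OF fin] by fastforce
  qed (use level_labels_order_of(2) order_of_interval_order level_labels_representation(2)[OF fin] in auto)
  have "finite (representations U k)" for k
    by (rule finite_subset[of _ "U \<rightarrow>\<^sub>E cells k"]) (auto simp: representations_def fin intro!: finite_PiE)
  then have "card (\<Union>k\<le>card U. representations U k) = (\<Sum>k\<le>card U. card (representations U k))"
    using level_labels_order_of(1) by (intro card_UN_disjoint) blast+
  with bij_betw_same_card[OF bij] show ?thesis by simp
qed

section \<open>Automorphisms of interval orders\<close>

lemma orbit_eq_iff: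
  assumes "\<sigma> permutes A" "finite A"
  shows "orbit \<sigma> x = orbit \<sigma> y \<longleftrightarrow> y \<in> orbit \<sigma> x"
proof -
  have perm: "permutation \<sigma>" using assms permutation_permutes by blast
  show ?thesis
    by (metis perm cyclic_on_alldef cyclic_on_orbit' permutation_self_in_orbit)
qed

text \<open>
  An automorphism maps the predecessor set of \<open>x\<close> onto that of \<open>\<sigma> x\<close>, so the two have the same number
  of elements; being members of a chain, they are equal.
\<close>

lemma automorphism_preserves_preds:
  assumes P: "P \<in> interval_orders U" and fin: "finite U" and \<sigma>: "bij_betw \<sigma> U U"
    and fixed: "transport_rel \<sigma> P = P" and "x \<in> U"
  shows "preds P (\<sigma> x) = preds P x"
proof -
  have sub: "P \<subseteq> U \<times> U" using P by (simp add: interval_orders_iff)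
  then have fin': "finite (preds P y)" for y
    using fin by (auto simp: preds_def intro: finite_subset[of _ U])
  have inj: "inj_on \<sigma> U" using \<sigma> by (simp add: bij_betw_def)
  have "preds (transport_rel \<sigma> P) (\<sigma> x) = \<sigma> ` preds P x"
    using sub inj \<open>x \<in> U\<close> by (auto simp: preds_def transport_rel_def inj_on_def)
  moreover have "preds P x \<subseteq> U" using sub by (auto simp: preds_def)
  ultimately have "card (preds P (\<sigma> x)) = card (preds P x)"
    using fixed by (simp add: card_image inj_on_subset[OF inj])
  then show ?thesis
    using preds_chain[OF P, of x "\<sigma> x"] fin' by (metis card_subset_eq)
qed

lemma transport_rel_converse: "transport_rel f (P\<inverse>) = (transport_rel f P)\<inverse>"
  by (auto simp: transport_rel_def)

lemma converse_interval_order: "P \<in> interval_orders U \<Longrightarrow> P\<inverse> \<in> interval_orders U"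
  unfolding interval_orders_iff irrefl_def by blast

text \<open>
  Applied to \<open>P\<close> and its converse, the previous fact shows that the points of a cycle of \<open>\<sigma>\<close> have the same
  predecessors and the same successors.
\<close>

lemma automorphism_step_iff:
  assumes P: "P \<in> interval_orders U" and fin: "finite U" and \<sigma>: "\<sigma> permutes U"
    and fixed: "transport_rel \<sigma> P = P" and "x \<in> U" "y \<in> U"
    and x': "x' \<in> orbit \<sigma> x" and y': "y' \<in> orbit \<sigma> y"
  shows "(x', y') \<in> P \<longleftrightarrow> (x, y) \<in> P"
proof -
  note bij = permutes_imp_bij[OF \<sigma>]
  have inv: "preds Q z' = preds Q z"
    if Q: "Q \<in> interval_orders U" "transport_rel \<sigma> Q = Q" and z: "z \<in> U" and z': "z' \<in> orbit \<sigma> z" for Q z z'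
    using z'
  proof (induction rule: orbit.induct)
    case base
    show ?case by (rule automorphism_preserves_preds[OF Q(1) fin bij Q(2) z])
  next
    case (step w)
    then have "w \<in> U" using permutes_orbit_subset[OF \<sigma> z] by blast
    then show ?case using automorphism_preserves_preds[OF Q(1) fin bij Q(2)] step by simp
  qed
  have "preds P y' = preds P y" by (rule inv[OF P fixed \<open>y \<in> U\<close> y'])
  moreover have "preds (P\<inverse>) x' = preds (P\<inverse>) x"
    by (rule inv[OF converse_interval_order[OF P] _ \<open>x \<in> U\<close> x']) (simp add: transport_rel_converse fixed)
  ultimately show ?thesis unfolding preds_def by (simp add: set_eq_iff)
qed

text \<open>
  An interval order fixed by \<open>\<sigma>\<close> is the pullback of a relation on the cycles of \<open>\<sigma>\<close>. The condition of
  \<open>interval_orders_iff\<close> passes between a relation and its pullback along a surjection.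
\<close>

lemma card_fixed_interval_orders:
  assumes fin: "finite U" and \<sigma>: "\<sigma> permutes U"
  shows "card {P \<in> interval_orders U. transport_rel \<sigma> P = P} =
         card (interval_orders (orbit \<sigma> ` U))"
proof -
  have self: "x \<in> orbit \<sigma> x" for x
    by (rule permutation_self_in_orbit) (use fin \<sigma> permutation_permutes in blast)
  have eq: "orbit \<sigma> x = orbit \<sigma> y \<longleftrightarrow> y \<in> orbit \<sigma> x" for x y
    by (rule orbit_eq_iff[OF \<sigma> fin])
  have step: "orbit \<sigma> (\<sigma> x) = orbit \<sigma> x" for x
    using eq[of x "\<sigma> x"] by (simp add: orbit.base)
  let ?pull = "\<lambda>Q. {(x, y) \<in> U \<times> U. (orbit \<sigma> x, orbit \<sigma> y) \<in> Q}"
  have lift: "(orbit \<sigma> x, orbit \<sigma> y) \<in> transport_rel (orbit \<sigma>) P \<longleftrightarrow> (x, y) \<in> P"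
    if P: "P \<in> interval_orders U" "transport_rel \<sigma> P = P" and xy: "x \<in> U" "y \<in> U" for P x y
  proof
    assume "(orbit \<sigma> x, orbit \<sigma> y) \<in> transport_rel (orbit \<sigma>) P"
    then obtain x' y' where *: "(x', y') \<in> P" "orbit \<sigma> x = orbit \<sigma> x'" "orbit \<sigma> y = orbit \<sigma> y'"
      by (auto simp: transport_rel_def)
    then have "x' \<in> orbit \<sigma> x" "y' \<in> orbit \<sigma> y" using self by blast+
    with * show "(x, y) \<in> P" using automorphism_step_iff[OF P(1) fin \<sigma> P(2)] xy by blast
  qed (auto simp: transport_rel_def)
  have "bij_betw (transport_rel (orbit \<sigma>)) {P \<in> interval_orders U. transport_rel \<sigma> P = P}
          (interval_orders (orbit \<sigma> ` U))"
  proof (rule bij_betw_byWitness[where f' = ?pull]; (intro ballI subsetI)?)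
    fix P assume "P \<in> {P \<in> interval_orders U. transport_rel \<sigma> P = P}"
    then have P: "P \<in> interval_orders U" "transport_rel \<sigma> P = P" by auto
    then have "P \<subseteq> U \<times> U" by (simp add: interval_orders_iff)
    then show "?pull (transport_rel (orbit \<sigma>) P) = P" using lift[OF P] by auto
  next
    fix Q assume "Q \<in> interval_orders (orbit \<sigma> ` U)"
    then have sub: "Q \<subseteq> orbit \<sigma> ` U \<times> orbit \<sigma> ` U" by (simp add: interval_orders_iff)
    show "transport_rel (orbit \<sigma>) (?pull Q) = Q"
    proof (rule set_eqI, clarify)
      fix X Y
      show "(X, Y) \<in> transport_rel (orbit \<sigma>) (?pull Q) \<longleftrightarrow> (X, Y) \<in> Q"
        using sub unfolding transport_rel_def by fastforce
    qed
  next
    fix R assume "R \<in> transport_rel (orbit \<sigma>) ` {P \<in> interval_orders U. transport_rel \<sigma> P = P}"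
    then obtain P where P: "P \<in> interval_orders U" "transport_rel \<sigma> P = P"
      and R: "R = transport_rel (orbit \<sigma>) P" by blast
    note lift = lift[OF P, folded R]
    have ferrers: "P \<subseteq> U \<times> U" "\<And>x. (x, x) \<notin> P"
      "\<And>x y z w. (x, y) \<in> P \<Longrightarrow> (z, w) \<in> P \<Longrightarrow> (x, w) \<in> P \<or> (z, y) \<in> P"
      using P(1) unfolding interval_orders_iff irrefl_def by blast+
    have sub: "R \<subseteq> orbit \<sigma> ` U \<times> orbit \<sigma> ` U"
      using ferrers(1) by (auto simp: transport_rel_def R)
    have points: "\<exists>x y. x \<in> U \<and> y \<in> U \<and> X = orbit \<sigma> x \<and> Y = orbit \<sigma> y" if "(X, Y) \<in> R" for X Y
      using subsetD[OF sub that] by auto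
    show "R \<in> interval_orders (orbit \<sigma> ` U)"
      unfolding interval_orders_iff irrefl_def
    proof (intro conjI allI impI notI)
      fix X assume "(X, X) \<in> R"
      moreover from points[OF this] obtain x where "x \<in> U" "X = orbit \<sigma> x" by blast
      ultimately show False using lift ferrers(2) by simp
    next
      fix X Y Z W assume *: "(X, Y) \<in> R" "(Z, W) \<in> R"
      from points[OF *(1)] points[OF *(2)] obtain x y z w
        where "x \<in> U" "y \<in> U" "z \<in> U" "w \<in> U"
          "X = orbit \<sigma> x" "Y = orbit \<sigma> y" "Z = orbit \<sigma> z" "W = orbit \<sigma> w" by blast
      then show "(X, W) \<in> R \<or> (Z, Y) \<in> R" using * lift ferrers(3) by simp
    qed (rule sub)
  next
    fix R assume "R \<in> ?pull ` interval_orders (orbit \<sigma> ` U)"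
    then obtain Q where Q: "Q \<in> interval_orders (orbit \<sigma> ` U)" and R: "R = ?pull Q" by blast
    have "R \<in> interval_orders U"
      using Q unfolding interval_orders_iff irrefl_def R by auto
    moreover have "transport_rel \<sigma> R = R"
    proof (rule set_eqI, clarify)
      fix x y
      obtain x' y' where *: "x = \<sigma> x'" "y = \<sigma> y'" using permutes_surj[OF \<sigma>] by (metis surjD)
      have "(x, y) \<in> transport_rel \<sigma> R \<longleftrightarrow> (x', y') \<in> R"
        unfolding transport_rel_def * using inj_eq[OF permutes_inj[OF \<sigma>]] by auto
      then show "(x, y) \<in> transport_rel \<sigma> R \<longleftrightarrow> (x, y) \<in> R"
        by (simp add: * R step permutes_in_image[OF \<sigma>])
    qed
    ultimately show "R \<in> {P \<in> interval_orders U. transport_rel \<sigma> P = P}" by blast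
  qed
  then show ?thesis by (rule bij_betw_same_card)
qed

section \<open>Counting labeled interval orders\<close>

text \<open>
  Inclusion-exclusion: the alternating sum runs over the subsets of \<open>C - g ` U\<close>.
\<close>

lemma onto_indicator:
  assumes "finite C" "g ` U \<subseteq> C"
  shows "(\<Sum>S\<in>Pow C. (-1) ^ card S * (if g ` U \<subseteq> C - S then 1 else 0)) =
         (if g ` U = C then 1 else 0 :: 'b::comm_ring_1)"
proof -
  have fin: "finite (C - g ` U)" using assms by simp
  have "(\<Sum>S\<in>Pow C. (-1) ^ card S * (if g ` U \<subseteq> C - S then 1 else 0)) =
        (\<Sum>S\<in>Pow (C - g ` U). (-1) ^ card S :: 'b)"
    using assms by (intro sum.mono_neutral_cong_right) auto
  also have "\<dots> = (\<Prod>x\<in>C - g ` U. 1 - 1)"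
    by (subst prod_diff_conv_sum[OF fin]) simp
  also have "\<dots> = (if g ` U = C then 1 else 0)"
    using assms fin by (auto simp: prod_zero_iff power_0_left card_eq_0_iff)
  finally show ?thesis .
qed

lemma sum_indicator: "finite A \<Longrightarrow> (\<Sum>h\<in>A. if Q h then 1 else 0) = (of_nat (card {h \<in> A. Q h}) :: 'b::comm_semiring_1)"
  by (simp add: sum.If_cases Int_def)

text \<open>
  Inclusion-exclusion on rows and columns: the summand for \<open>S\<close> and \<open>R\<close> counts the labellings that avoid
  the columns in \<open>S\<close> and the rows in \<open>R\<close>, where row \<open>i\<close> has \<open>card ({..i} - S)\<close> cells left.
\<close>

lemma card_representations:
  fixes U :: "'a set"
  assumes fin: "finite U"
  shows "(of_nat (card (representations U k)) :: rat) =
    (\<Sum>S\<in>Pow {..<k}. \<Sum>R\<in>Pow {..<k}. (-1) ^ card S * (-1) ^ card R *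
        of_nat (\<Sum>i\<in>{..<k} - R. card ({..i} - S)) ^ card U)"
proof -
  let ?H = "U \<rightarrow>\<^sub>E cells k"
  let ?into = "\<lambda>g C. if g ` U \<subseteq> C then 1 else (0::rat)"
  have finH: "finite ?H" using fin by (simp add: finite_PiE)
  have ran: "(fst \<circ> h) ` U \<subseteq> {..<k}" "(snd \<circ> h) ` U \<subseteq> {..<k}" if "h \<in> ?H" for h
    using that by (fastforce simp: cells_def PiE_iff)+
  have count: "(\<Sum>h\<in>?H. ?into (fst \<circ> h) ({..<k} - R) * ?into (snd \<circ> h) ({..<k} - S)) =
      of_nat (\<Sum>i\<in>{..<k} - R. card ({..i} - S)) ^ card U" if S: "S \<subseteq> {..<k}" for R S
  proof -
    let ?cells = "SIGMA i:{..<k} - R. {..i} - S"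
    have "{h \<in> ?H. (fst \<circ> h) ` U \<subseteq> {..<k} - R \<and> (snd \<circ> h) ` U \<subseteq> {..<k} - S} = U \<rightarrow>\<^sub>E ?cells"
    proof -
      have "h x \<in> cells k \<and> fst (h x) \<in> {..<k} - R \<and> snd (h x) \<in> {..<k} - S \<longleftrightarrow> h x \<in> ?cells"
        for h :: "'a \<Rightarrow> nat \<times> nat" and x
        by (cases "h x") (auto simp: cells_def)
      then show ?thesis
        unfolding set_eq_iff PiE_iff mem_Collect_eq image_subset_iff o_apply by blast
    qed
    moreover have "(\<Sum>h\<in>?H. ?into (fst \<circ> h) ({..<k} - R) * ?into (snd \<circ> h) ({..<k} - S)) =
      (\<Sum>h\<in>?H. if (fst \<circ> h) ` U \<subseteq> {..<k} - R \<and> (snd \<circ> h) ` U \<subseteq> {..<k} - S then 1 else 0)"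
      by (rule sum.cong) auto
    ultimately show ?thesis
      by (simp add: sum_indicator finH card_funcsetE fin)
  qed
  have "(of_nat (card (representations U k)) :: rat) =
      (\<Sum>h\<in>?H. (if (fst \<circ> h) ` U = {..<k} then 1 else 0) * (if (snd \<circ> h) ` U = {..<k} then 1 else 0))"
    unfolding representations_def sum_indicator[OF finH, symmetric] by (rule sum.cong) auto
  also have "\<dots> = (\<Sum>h\<in>?H. (\<Sum>R\<in>Pow {..<k}. (-1) ^ card R * ?into (fst \<circ> h) ({..<k} - R)) *
      (\<Sum>S\<in>Pow {..<k}. (-1) ^ card S * ?into (snd \<circ> h) ({..<k} - S)))"
    by (intro sum.cong refl, subst (1 2) onto_indicator) (use ran in auto)
  also have "\<dots> = (\<Sum>h\<in>?H. \<Sum>S\<in>Pow {..<k}. \<Sum>R\<in>Pow {..<k}. (-1) ^ card S * (-1) ^ card R *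
      (?into (fst \<circ> h) ({..<k} - R) * ?into (snd \<circ> h) ({..<k} - S)))"
    by (subst sum.swap[of _ "Pow {..<k}" "Pow {..<k}"]) (simp only: sum_product mult_ac)
  also have "\<dots> = (\<Sum>S\<in>Pow {..<k}. \<Sum>R\<in>Pow {..<k}. (-1) ^ card S * (-1) ^ card R *
      (\<Sum>h\<in>?H. ?into (fst \<circ> h) ({..<k} - R) * ?into (snd \<circ> h) ({..<k} - S)))"
    by (subst sum.swap, intro sum.cong refl, subst sum.swap) (simp only: sum_distrib_left)
  also have "\<dots> = (\<Sum>S\<in>Pow {..<k}. \<Sum>R\<in>Pow {..<k}. (-1) ^ card S * (-1) ^ card R *
        of_nat (\<Sum>i\<in>{..<k} - R. card ({..i} - S)) ^ card U)"
    using count by (intro sum.cong refl) (simp only: Pow_iff)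
  finally show ?thesis .
qed

abbreviation fexp :: "nat \<Rightarrow> rat fps" where "fexp c \<equiv> fps_exp (of_nat c)"

lemma fps_exp_sum:
  "finite A \<Longrightarrow> (\<Prod>i\<in>A. fexp (f i)) = fexp (\<Sum>i\<in>A. f i)"
  by (induction A rule: finite_induct) (simp_all add: fps_exp_add_mult)

text \<open>
  In the exponential generating function, a row with \<open>c\<close> available cells contributes \<open>fps_exp c\<close>, so the sum over the
  avoided rows factors into one factor \<open>fps_exp c - 1\<close> for each row.
\<close>

lemma card_representations_egf:
  fixes U :: "'a set"
  assumes fin: "finite U"
  shows "of_nat (card (representations U k)) / fact (card U) =
    (\<Sum>S\<in>Pow {..<k}. (-1) ^ card S * (\<Prod>i<k. fexp (card ({..i} - S)) - 1)) $ card U"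
proof -
  have "(\<Prod>i<k. fexp (card ({..i} - S)) - 1) =
      (\<Sum>R\<in>Pow {..<k}. (-1) ^ card R * fexp (\<Sum>i\<in>{..<k} - R. card ({..i} - S)))" for S
    by (subst prod_diff_conv_sum) (simp_all add: fps_exp_sum)
  moreover have "((-1) ^ j * f) $ n = (-1) ^ j * f $ n" for j n and f :: "rat fps"
    by (cases "even j") auto
  ultimately show ?thesis
    unfolding card_representations[OF fin]
    by (simp add: fps_sum_nth sum_distrib_left sum_divide_distrib mult.assoc)
qed

text \<open>
  The total signed weight of the sets \<open>S \<subseteq> {..<k}\<close> of avoided columns that leave \<open>c\<close> columns. Reading
  the columns one by one gives a walk whose height is the number of columns kept so far: a step that
  arrives at height \<open>c\<close> weighs \<open>fps_exp c - 1\<close>, with a minus sign if it stays there. Nothing stays at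
  height \<open>0\<close>, since \<open>fps_exp 0 - 1 = 0\<close>.
\<close>

fun walk_weight :: "nat \<Rightarrow> nat \<Rightarrow> rat fps" where
  "walk_weight 0 c = (if c = 0 then 1 else 0)"
| "walk_weight (Suc k) 0 = 0"
| "walk_weight (Suc k) (Suc c) = (fexp (Suc c) - 1) * (walk_weight k c - walk_weight k (Suc c))"

lemma walk_weight_eq_0: "k < c \<Longrightarrow> walk_weight k c = 0"
  by (induction k c rule: walk_weight.induct) auto

lemma walk_weight_nth_eq_0: "n < k \<Longrightarrow> walk_weight k c $ n = 0"
proof (induction k c arbitrary: n rule: walk_weight.induct)
  case (3 k c)
  have "(fexp (Suc c) - 1) $ i * (walk_weight k c - walk_weight k (Suc c)) $ (n - i) = 0" if "i \<le> n" for i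
    using that 3 by (cases "i = 0") auto
  then show ?case by (simp only: walk_weight.simps fps_mult_nth) (simp add: sum.neutral)
qed auto

text \<open>
  The weight function \<open>g\<close> of the final height is arbitrary, because the induction on \<open>k\<close> absorbs
  the last step of the walk into \<open>g\<close>.
\<close>

lemma sieve_eq_walks:
  "(\<Sum>S\<in>Pow {..<k}. (-1) ^ card S * (\<Prod>i<k. fexp (card ({..i} - S)) - 1) * g (card ({..<k} - S))) =
   (\<Sum>c\<le>k. walk_weight k c * g c)"
proof (induction k arbitrary: g)
  case 0
  then show ?case by simp
next
  case (Suc k)
  let ?E = "\<lambda>c. fexp c - 1"
  let ?P = "\<lambda>S. \<Prod>i<k. ?E (card ({..i} - S))"
  let ?term = "\<lambda>S. (-1) ^ card S * (\<Prod>i<Suc k. ?E (card ({..i} - S))) * g (card ({..<Suc k} - S))"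
  define g' where "g' c = ?E (Suc c) * g (Suc c) - ?E c * g c" for c
  have fin: "finite S" if "S \<subseteq> {..<k}" for S using that finite_subset by blast
  have kept: "?term S = (-1) ^ card S * ?P S * (?E (Suc (card ({..<k} - S))) * g (Suc (card ({..<k} - S))))"
    if S: "S \<subseteq> {..<k}" for S
  proof -
    have "{..k} - S = insert k ({..<k} - S)" "{..<Suc k} - S = insert k ({..<k} - S)"
      using S by (auto simp: lessThan_Suc)
    then show ?thesis by simp
  qed
  have removed: "?term (insert k S) = - ((-1) ^ card S * ?P S * (?E (card ({..<k} - S)) * g (card ({..<k} - S))))"
    if S: "S \<subseteq> {..<k}" for S
  proof -
    have "{..k} - insert k S = {..<k} - S" "{..<Suc k} - insert k S = {..<k} - S"
      by (auto simp: lessThan_Suc)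
    moreover have "(\<Prod>i<k. ?E (card ({..i} - insert k S))) = ?P S"
      by (intro prod.cong refl arg_cong[where f = "\<lambda>A. ?E (card A)"]) auto
    moreover have "k \<notin> S" using S by auto
    ultimately show ?thesis by (simp add: fin[OF S])
  qed
  have "(\<Sum>S\<in>Pow {..<Suc k}. ?term S) = (\<Sum>S\<in>Pow {..<k}. ?term S) + (\<Sum>S\<in>insert k ` Pow {..<k}. ?term S)"
    unfolding lessThan_Suc[of k] Pow_insert by (rule sum.union_disjoint) auto
  also have "(\<Sum>S\<in>insert k ` Pow {..<k}. ?term S) = (\<Sum>S\<in>Pow {..<k}. ?term (insert k S))"
    by (subst sum.reindex) (auto simp: inj_on_def o_def)
  also have "(\<Sum>S\<in>Pow {..<k}. ?term S) + (\<Sum>S\<in>Pow {..<k}. ?term (insert k S)) =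
      (\<Sum>S\<in>Pow {..<k}. (-1) ^ card S * ?P S * g' (card ({..<k} - S)))"
    unfolding sum.distrib[symmetric]
  proof (intro sum.cong refl)
    fix S assume "S \<in> Pow {..<k}"
    then have S: "S \<subseteq> {..<k}" by simp
    show "?term S + ?term (insert k S) = (-1) ^ card S * ?P S * g' (card ({..<k} - S))"
      unfolding kept[OF S] removed[OF S] g'_def by (simp add: right_diff_distrib)
  qed
  also have "\<dots> = (\<Sum>c\<le>k. walk_weight k c * g' c)" by (rule Suc.IH)
  also have "\<dots> = (\<Sum>c\<le>k. walk_weight k c * (?E (Suc c) * g (Suc c))) - (\<Sum>c\<le>Suc k. walk_weight k c * (?E c * g c))"
    by (simp add: g'_def right_diff_distrib sum_subtractf walk_weight_eq_0)
  also have "(\<Sum>c\<le>Suc k. walk_weight k c * (?E c * g c)) =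
      (\<Sum>c\<le>k. walk_weight k (Suc c) * (?E (Suc c) * g (Suc c)))"
    by (subst sum.atMost_Suc_shift) simp
  also have "(\<Sum>c\<le>k. walk_weight k c * (?E (Suc c) * g (Suc c))) - \<dots> =
      (\<Sum>c\<le>k. walk_weight (Suc k) (Suc c) * g (Suc c))"
    by (simp add: sum_subtractf[symmetric] algebra_simps)
  also have "\<dots> = (\<Sum>c\<le>Suc k. walk_weight (Suc k) c * g c)"
    by (subst sum.atMost_Suc_shift) simp
  finally show ?case .
qed

definition fishburn_prod :: "nat \<Rightarrow> rat fps" where
  "fishburn_prod m = (\<Prod>i=1..m. 1 - fps_exp (- of_nat i))"

lemma fishburn_prod_Suc: "fishburn_prod (Suc m) = fishburn_prod m * (1 - fps_exp (- of_nat (Suc m)))"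
  by (simp add: fishburn_prod_def)

lemma fps_prod_nth_eq_0:
  fixes f :: "nat \<Rightarrow> 'a::comm_ring_1 fps"
  assumes "\<And>i. f i $ 0 = 0" and "n < m"
  shows "(\<Prod>i=1..m. f i) $ n = 0"
  using assms(2)
proof (induction m arbitrary: n)
  case (Suc m)
  have "(\<Prod>i=1..m. f i) $ i * f (Suc m) $ (n - i) = 0" if "i \<le> n" for i
    using that Suc assms(1) by (cases "i = n") auto
  then show ?case by (simp add: fps_mult_nth sum.neutral)
qed simp

lemma fishburn_prod_nth_eq_0: "n < m \<Longrightarrow> fishburn_prod m $ n = 0"
  unfolding fishburn_prod_def by (rule fps_prod_nth_eq_0) auto

text \<open>
  Summing over all lengths of the walk turns the stays at height \<open>c\<close> into the geometric series
  \<open>1 / (1 + (fps_exp c - 1)) = fps_exp (- c)\<close>; together with the step up to \<open>c\<close> this gives the factor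
  \<open>(fps_exp c - 1) * fps_exp (- c) = 1 - fps_exp (- c)\<close>. Walks of more than \<open>n\<close> steps do not contribute to
  the coefficient of order \<open>n\<close>, which is why a partial sum is enough.
\<close>

lemma sum_walk_weight_nth:
  "n \<le> N \<Longrightarrow> (\<Sum>k\<le>N. walk_weight k c) $ n = fishburn_prod c $ n"
proof (induction c arbitrary: n)
  case 0
  have "(\<Sum>k\<le>N. walk_weight k 0) = 1"
    by (subst sum.atMost_shift) simp
  then show ?case by (simp add: fishburn_prod_def)
next
  case (Suc c)
  let ?B = "\<lambda>c. \<Sum>k\<le>N. walk_weight k c" and ?e = "fexp (Suc c)" and ?e' = "fps_exp (- of_nat (Suc c)) :: rat fps"
  have solve: "e * x = (e - 1) * b - w" if "x + w = (e - 1) * (b - x)" for e x b w :: "rat fps"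
  proof -
    from that have "w = (e - 1) * (b - x) - x" by (simp add: eq_diff_eq add.commute)
    then show ?thesis by (simp add: algebra_simps)
  qed
  have "?B (Suc c) + walk_weight (Suc N) (Suc c) = (\<Sum>k\<le>Suc N. walk_weight k (Suc c))"
    by simp
  also have "\<dots> = (\<Sum>k\<le>N. walk_weight (Suc k) (Suc c))"
    by (subst sum.atMost_Suc_shift) simp
  also have "\<dots> = (?e - 1) * (?B c - ?B (Suc c))"
    by (simp only: walk_weight.simps sum_distrib_left[symmetric] sum_subtractf)
  finally have rec: "?e * ?B (Suc c) = (?e - 1) * ?B c - walk_weight (Suc N) (Suc c)"
    by (rule solve)
  have inv: "?e' * ?e = 1"
    by (simp only: fps_exp_add_mult[symmetric]) simp
  have "?B (Suc c) = ?e' * (?e * ?B (Suc c))"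
    by (simp only: mult.assoc[symmetric] inv mult_1_left)
  also have "\<dots> = (?e' * ?e - ?e') * ?B c - ?e' * walk_weight (Suc N) (Suc c)"
    unfolding rec by (simp only: algebra_simps mult_1_left)
  finally have B: "?B (Suc c) = (1 - ?e') * ?B c - ?e' * walk_weight (Suc N) (Suc c)"
    unfolding inv .
  have "(?e' * walk_weight (Suc N) (Suc c)) $ n = 0"
    unfolding fps_mult_nth using Suc.prems
    by (intro sum.neutral ballI) (simp only: walk_weight_nth_eq_0 mult_zero_right)
  moreover have "((1 - ?e') * ?B c) $ n = ((1 - ?e') * fishburn_prod c) $ n"
    unfolding fps_mult_nth using Suc by (intro sum.cong refl) simp
  ultimately show ?case
    unfolding B fishburn_prod_Suc by (simp only: fps_sub_nth mult.commute diff_zero)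
qed

theorem card_interval_orders:
  assumes "finite U"
  shows "of_nat (card (interval_orders U)) = fact (card U) * (\<Sum>c\<le>card U. fishburn_prod c) $ card U"
proof -
  let ?n = "card U"
  have "(of_nat (card (interval_orders U)) :: rat) / fact ?n =
      (\<Sum>k\<le>?n. of_nat (card (representations U k)) / fact ?n)"
    by (simp add: card_interval_orders_eq_sum[OF assms] sum_divide_distrib)
  also have "\<dots> = (\<Sum>k\<le>?n. (\<Sum>c\<le>k. walk_weight k c) $ ?n)"
    unfolding card_representations_egf[OF assms] using sieve_eq_walks[of _ "\<lambda>_. 1"] by simp
  also have "\<dots> = (\<Sum>k\<le>?n. (\<Sum>c\<le>?n. walk_weight k c) $ ?n)"
    by (intro sum.cong refl arg_cong2[where f = fps_nth] sum.mono_neutral_left) (auto simp: walk_weight_eq_0)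
  also have "\<dots> = (\<Sum>c\<le>?n. (\<Sum>k\<le>?n. walk_weight k c) $ ?n)"
    unfolding fps_sum_nth by (rule sum.swap)
  also have "\<dots> = (\<Sum>c\<le>?n. fishburn_prod c) $ ?n"
    unfolding sum_walk_weight_nth[OF order_refl] by (simp add: fps_sum_nth)
  finally show ?thesis by (simp add: field_simps)
qed

text \<open>
  The count of \<open>card_interval_orders\<close> depends on the ground set only through its cardinality, even across types; this is
  needed where the ground set consists of the cycles of a permutation.
\<close>

lemma card_interval_orders_eq:
  assumes "finite U" "n = card U"
  shows "card (interval_orders U) = card (interval_orders {1..n})"
proof -
  have "(of_nat (card (interval_orders U)) :: rat) = of_nat (card (interval_orders {1..n}))"
    using assms by (simp only: card_interval_orders finite_atLeastAtMost card_atLeastAtMost) simp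
  then show ?thesis by simp
qed

lemma gen_series_nth_eq_sum:
  assumes "n < N"
  shows "gen_series interval_order_species $ n = (\<Sum>m<N. fishburn_prod m) $ n"
proof -
  have "(\<Sum>m<N. fishburn_prod m) $ n = (\<Sum>m\<le>n. fishburn_prod m) $ n"
    unfolding fps_sum_nth using assms by (intro sum.mono_neutral_right) (auto simp: fishburn_prod_nth_eq_0)
  also have "\<dots> = gen_series interval_order_species $ n"
    using card_interval_orders[of "{1..n}"]
    by (simp add: gen_series_def interval_order_species_def field_simps)
  finally show ?thesis ..
qed

theorem fishburn_prod_sums_gen_series:
  "fishburn_prod sums gen_series interval_order_species"
  unfolding sums_def tendsto_fps_iff eventually_sequentially
  using gen_series_nth_eq_sum Suc_le_lessD by metis

section \<open>Cycle types of permutations\<close>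

text \<open>
  The multiset of cycle lengths is the exponent of the monomial that a permutation contributes to a
  cycle index, so it can be compared with exponents in \<open>mfps\<close> directly.
\<close>

definition cycle_type :: "'a set \<Rightarrow> ('a \<Rightarrow> 'a) \<Rightarrow> nat multiset" where
  "cycle_type A \<sigma> = image_mset card (mset_set (orbit \<sigma> ` A))"

lemma size_cycle_type: "size (cycle_type A \<sigma>) = card (orbit \<sigma> ` A)"
  by (simp add: cycle_type_def)

lemma self_in_orbit:
  assumes "\<sigma> permutes A" "finite A" shows "x \<in> orbit \<sigma> x"
  by (rule permutation_self_in_orbit) (use assms permutation_permutes in blast)

lemma orbits_insert_fixpoint:
  assumes \<sigma>: "\<sigma> permutes A" and "a \<notin> A"
  shows "orbit \<sigma> ` insert a A = insert {a} (orbit \<sigma> ` A)"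
proof -
  have "\<sigma> a = a" using assms by (simp add: permutes_not_in)
  then have "orbit \<sigma> a = {a}" by (simp add: orbit_eq_singleton_iff)
  then show ?thesis by simp
qed

text \<open>
  Composing with the transposition inserts \<open>a\<close> into the cycle of \<open>b\<close>, immediately before \<open>b\<close>.
\<close>

lemma orbits_insert_into_cycle:
  assumes \<sigma>: "\<sigma> permutes A" and fin: "finite A" and a: "a \<notin> A" and b: "b \<in> A"
  shows "orbit (transpose a b \<circ> \<sigma>) ` insert a A =
         insert (insert a (orbit \<sigma> b)) (orbit \<sigma> ` A - {orbit \<sigma> b})"
proof -
  let ?\<tau> = "transpose a b \<circ> \<sigma>"
  have \<tau>: "?\<tau> permutes insert a A"
    using \<sigma> b by (intro permutes_compose permutes_swap_id permutes_subset[OF \<sigma>]) auto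
  have fin': "finite (insert a A)" using fin by simp
  have \<tau>a: "?\<tau> a = b" using permutes_not_in[OF \<sigma> a] by simp
  have \<tau>x: "?\<tau> x = (if \<sigma> x = b then a else \<sigma> x)" if "x \<in> A" for x
    using a permutes_in_image[OF \<sigma>, of x] that by (auto simp: transpose_def)
  have inA: "y \<in> A" if "y \<in> orbit \<sigma> x" "x \<in> A" for x y
    using permutes_orbit_subset[OF \<sigma> that(2)] that(1) by blast
  have jump: "\<sigma> y \<in> orbit ?\<tau> x" if y: "y \<in> A" and *: "?\<tau> y \<in> orbit ?\<tau> x" for x y
  proof (cases "\<sigma> y = b")
    case True
    then have "?\<tau> y = a" using \<tau>x[OF y] by simp
    with * have "?\<tau> a \<in> orbit ?\<tau> x" by (metis orbit.step)
    then show ?thesis using True \<tau>a by simp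
  qed (use * \<tau>x[OF y] in simp)
  have sub: "y \<in> orbit ?\<tau> x" if "y \<in> orbit \<sigma> x" "x \<in> A" for x y
    using that(1)
  proof (induction rule: orbit.induct)
    case base
    show ?case by (rule jump[OF that(2) orbit.base])
  next
    case (step y)
    show ?case by (rule jump[OF inA[OF step.hyps that(2)] orbit.step[OF step.IH]])
  qed
  have sup: "y \<in> orbit \<sigma> x \<or> (y = a \<and> b \<in> orbit \<sigma> x)" if "y \<in> orbit ?\<tau> x" "x \<in> A" for x y
    using that(1)
  proof (induction rule: orbit.induct)
    case base
    show ?case using \<tau>x[OF that(2)] orbit.base[of \<sigma> x] by auto
  next
    case (step y)
    from step.IH show ?case
    proof
      assume y: "y \<in> orbit \<sigma> x"
      then have "\<sigma> y \<in> orbit \<sigma> x" by (rule orbit.step)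
      then show ?thesis using \<tau>x[OF inA[OF y that(2)]] by auto
    qed (use \<tau>a in simp)
  qed
  note self = self_in_orbit[OF \<sigma> fin] and self' = self_in_orbit[OF \<tau> fin']
  note eq = orbit_eq_iff[OF \<sigma> fin] and eq' = orbit_eq_iff[OF \<tau> fin']
  have ab: "orbit ?\<tau> a = orbit ?\<tau> b"
    using eq'[of a b] orbit.base[of ?\<tau> a] \<tau>a by simp
  have other: "orbit ?\<tau> x = orbit \<sigma> x" if x: "x \<in> A" and ne: "orbit \<sigma> x \<noteq> orbit \<sigma> b" for x
  proof (intro equalityI subsetI)
    fix y assume "y \<in> orbit ?\<tau> x"
    then show "y \<in> orbit \<sigma> x" using sup[OF _ x] ne eq[of x b] by blast
  qed (use sub x in blast)
  have same: "orbit ?\<tau> b = insert a (orbit \<sigma> b)"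
  proof (intro equalityI subsetI)
    fix y assume "y \<in> insert a (orbit \<sigma> b)"
    then show "y \<in> orbit ?\<tau> b" using sub[OF _ b] ab self'[of a] by auto
  qed (use sup[OF _ b] in blast)
  have "orbit ?\<tau> x = (if orbit \<sigma> x = orbit \<sigma> b then insert a (orbit \<sigma> b) else orbit \<sigma> x)"
    if x: "x \<in> A" for x
  proof (cases "orbit \<sigma> x = orbit \<sigma> b")
    case True
    then have "x \<in> orbit \<sigma> b" using self[of x] by simp
    then have "x \<in> orbit ?\<tau> b" by (rule sub[OF _ b])
    then show ?thesis using True same eq'[of b x] by simp
  qed (use other x in simp)
  then have "orbit ?\<tau> ` A =
      (\<lambda>C. if C = orbit \<sigma> b then insert a (orbit \<sigma> b) else C) ` orbit \<sigma> ` A"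
    unfolding image_image by (intro image_cong refl) simp
  also have "\<dots> = insert (insert a (orbit \<sigma> b)) (orbit \<sigma> ` A - {orbit \<sigma> b})"
    using imageI[OF b, of "orbit \<sigma>"] by auto
  finally have "orbit ?\<tau> ` A = \<dots>" .
  then show ?thesis using ab b by auto
qed

lemma cycle_type_insert_fixpoint:
  assumes \<sigma>: "\<sigma> permutes A" and fin: "finite A" and a: "a \<notin> A"
  shows "cycle_type (insert a A) \<sigma> = add_mset 1 (cycle_type A \<sigma>)"
proof -
  have "{a} \<notin> orbit \<sigma> ` A"
    using permutes_orbit_subset[OF \<sigma>] a by blast
  then show ?thesis
    unfolding cycle_type_def orbits_insert_fixpoint[OF \<sigma> a] using fin by simp
qed

lemma cycle_type_insert_into_cycle:
  assumes \<sigma>: "\<sigma> permutes A" and fin: "finite A" and a: "a \<notin> A" and b: "b \<in> A"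
  shows "cycle_type (insert a A) (transpose a b \<circ> \<sigma>) =
         add_mset (Suc (card (orbit \<sigma> b))) (cycle_type A \<sigma> - {#card (orbit \<sigma> b)#})"
proof -
  let ?O = "orbit \<sigma> ` A" and ?C = "orbit \<sigma> b"
  have sub: "C \<subseteq> A" if "C \<in> ?O" for C
    using permutes_orbit_subset[OF \<sigma>] that by blast
  have C: "?C \<in> ?O" using b by simp
  have "insert a ?C \<notin> ?O" using sub a by blast
  moreover have "mset_set (?O - {?C}) = mset_set ?O - {#?C#}"
    using fin C by (simp add: mset_set_Diff)
  moreover have "?C \<in># mset_set ?O" using fin C by simp
  moreover have "card (insert a ?C) = Suc (card ?C)"
    using sub[OF C] a fin finite_subset by (subst card_insert_disjoint) auto
  ultimately show ?thesis
    unfolding cycle_type_def orbits_insert_into_cycle[OF assms]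
    using fin by (simp add: image_mset_Diff)
qed

lemma sum_over_points_eq_sum_over_cycles:
  fixes g :: "nat \<Rightarrow> 'b::comm_semiring_1"
  assumes \<sigma>: "\<sigma> permutes A" and fin: "finite A"
  shows "(\<Sum>b\<in>A. g (card (orbit \<sigma> b))) = (\<Sum>l\<in>#cycle_type A \<sigma>. of_nat l * g l)"
proof -
  have "(\<Sum>b\<in>A. g (card (orbit \<sigma> b))) = (\<Sum>C\<in>orbit \<sigma> ` A. \<Sum>b\<in>{b \<in> A. orbit \<sigma> b = C}. g (card (orbit \<sigma> b)))"
    using fin by (intro sum.group[symmetric]) auto
  also have "\<dots> = (\<Sum>C\<in>orbit \<sigma> ` A. of_nat (card C) * g (card C))"
  proof (rule sum.cong[OF refl])
    fix C assume "C \<in> orbit \<sigma> ` A"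
    then obtain x where x: "x \<in> A" "C = orbit \<sigma> x" by blast
    have "orbit \<sigma> b = C \<longleftrightarrow> b \<in> C" for b
      using orbit_eq_iff[OF \<sigma> fin, of x b] x(2) by auto
    then have "{b \<in> A. orbit \<sigma> b = C} = C"
      using permutes_orbit_subset[OF \<sigma> x(1)] x(2) by auto
    moreover have "(\<Sum>b\<in>{b \<in> A. orbit \<sigma> b = C}. g (card (orbit \<sigma> b))) = (\<Sum>b\<in>{b \<in> A. orbit \<sigma> b = C}. g (card C))"
      by (rule sum.cong) auto
    ultimately show "(\<Sum>b\<in>{b \<in> A. orbit \<sigma> b = C}. g (card (orbit \<sigma> b))) = of_nat (card C) * g (card C)"
      by simp
  qed
  also have "\<dots> = (\<Sum>l\<in>#cycle_type A \<sigma>. of_nat l * g l)"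
    by (simp add: cycle_type_def sum_unfold_sum_mset image_mset.compositionality o_def)
  finally show ?thesis .
qed

text \<open>
  Every permutation of \<open>insert a A\<close> arises exactly once from a permutation of \<open>A\<close>, either with \<open>a\<close> as a new
  fixed point or by inserting \<open>a\<close> before some \<open>b \<in> A\<close>; a cycle of length \<open>l\<close> offers \<open>l\<close> choices of \<open>b\<close>.
\<close>

lemma sum_over_cycle_types_insert:
  fixes \<Phi> :: "nat multiset \<Rightarrow> 'b::comm_semiring_1"
  assumes fin: "finite A" and a: "a \<notin> A"
  shows "(\<Sum>\<sigma> | \<sigma> permutes insert a A. \<Phi> (cycle_type (insert a A) \<sigma>)) =
    (\<Sum>\<sigma> | \<sigma> permutes A. \<Phi> (add_mset 1 (cycle_type A \<sigma>)) +
       (\<Sum>l\<in>#cycle_type A \<sigma>. of_nat l * \<Phi> (add_mset (Suc l) (cycle_type A \<sigma> - {#l#}))))"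
proof -
  have "(\<Sum>\<sigma> | \<sigma> permutes insert a A. \<Phi> (cycle_type (insert a A) \<sigma>)) =
     (\<Sum>\<sigma> | \<sigma> permutes A. \<Sum>b\<in>insert a A. \<Phi> (cycle_type (insert a A) (transpose a b \<circ> \<sigma>)))"
    unfolding sum_over_permutations_insert[OF fin a] by (rule sum.swap)
  also have "\<dots> = (\<Sum>\<sigma> | \<sigma> permutes A. \<Phi> (add_mset 1 (cycle_type A \<sigma>)) +
       (\<Sum>l\<in>#cycle_type A \<sigma>. of_nat l * \<Phi> (add_mset (Suc l) (cycle_type A \<sigma> - {#l#}))))"
  proof (rule sum.cong[OF refl])
    fix \<sigma> assume "\<sigma> \<in> {\<sigma>. \<sigma> permutes A}"
    then have \<sigma>: "\<sigma> permutes A" by simp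
    have "(\<Sum>b\<in>insert a A. \<Phi> (cycle_type (insert a A) (transpose a b \<circ> \<sigma>))) =
        \<Phi> (add_mset 1 (cycle_type A \<sigma>)) +
        (\<Sum>b\<in>A. \<Phi> (add_mset (Suc (card (orbit \<sigma> b))) (cycle_type A \<sigma> - {#card (orbit \<sigma> b)#})))"
      using fin a by (simp add: cycle_type_insert_fixpoint[OF \<sigma>] cycle_type_insert_into_cycle[OF \<sigma>])
    also have "\<dots> = \<Phi> (add_mset 1 (cycle_type A \<sigma>)) +
       (\<Sum>l\<in>#cycle_type A \<sigma>. of_nat l * \<Phi> (add_mset (Suc l) (cycle_type A \<sigma> - {#l#})))"
      by (subst sum_over_points_eq_sum_over_cycles[OF \<sigma> fin,
            of "\<lambda>l. \<Phi> (add_mset (Suc l) (cycle_type A \<sigma> - {#l#}))"]) (rule refl)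
    finally show "(\<Sum>b\<in>insert a A. \<Phi> (cycle_type (insert a A) (transpose a b \<circ> \<sigma>))) = \<dots>" .
  qed
  finally show ?thesis .
qed

lemma sum_mset_cycle_type:
  assumes \<sigma>: "\<sigma> permutes A" and fin: "finite A"
  shows "sum_mset (cycle_type A \<sigma>) = card A"
  using sum_over_points_eq_sum_over_cycles[OF assms, of "\<lambda>_. 1 :: nat"] by simp

text \<open>
  This is the generating function of the unsigned Stirling numbers of the first kind. An insertion either adds a cycle,
  or keeps the number of cycles in one of \<open>card A\<close> ways.
\<close>

lemma sum_power_cycle_number:
  fixes t :: "'b::comm_ring_1"
  assumes "finite A"
  shows "(\<Sum>\<sigma> | \<sigma> permutes A. t ^ card (orbit \<sigma> ` A)) = pochhammer t (card A)"
  using assms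
proof (induction A rule: finite_induct)
  case empty
  then show ?case by simp
next
  case (insert a A)
  have "(\<Sum>\<sigma> | \<sigma> permutes insert a A. t ^ size (cycle_type (insert a A) \<sigma>)) =
      (\<Sum>\<sigma> | \<sigma> permutes A. (t + of_nat (card A)) * t ^ size (cycle_type A \<sigma>))"
    unfolding sum_over_cycle_types_insert[OF insert.hyps, of "\<lambda>m. t ^ size m"]
  proof (rule sum.cong[OF refl])
    fix \<sigma> assume "\<sigma> \<in> {\<sigma>. \<sigma> permutes A}"
    then have \<sigma>: "\<sigma> permutes A" by simp
    have "(\<Sum>l\<in>#cycle_type A \<sigma>. of_nat l * t ^ size (add_mset (Suc l) (cycle_type A \<sigma> - {#l#}))) =
        (\<Sum>l\<in>#cycle_type A \<sigma>. of_nat l * t ^ size (cycle_type A \<sigma>))"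
      by (intro arg_cong[where f = sum_mset] image_mset_cong) (simp add: size_Suc_Diff1)
    also have "\<dots> = (\<Sum>l\<in>#cycle_type A \<sigma>. of_nat l) * t ^ size (cycle_type A \<sigma>)"
      by (simp add: sum_mset_distrib_right)
    also have "(\<Sum>l\<in>#cycle_type A \<sigma>. of_nat l) = (of_nat (card A) :: 'b)"
      by (simp add: sum_mset_cycle_type[OF \<sigma> insert.hyps(1), symmetric] of_nat_sum_mset)
    finally show "t ^ size (add_mset 1 (cycle_type A \<sigma>)) +
        (\<Sum>l\<in>#cycle_type A \<sigma>. of_nat l * t ^ size (add_mset (Suc l) (cycle_type A \<sigma> - {#l#}))) =
        (t + of_nat (card A)) * t ^ size (cycle_type A \<sigma>)"
      by (simp add: distrib_right)
  qed
  also have "\<dots> = (t + of_nat (card A)) * pochhammer t (card A)"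
    unfolding size_cycle_type insert.IH[symmetric] by (simp add: sum_distrib_left)
  finally show ?case
    using insert.hyps by (simp add: size_cycle_type pochhammer_Suc mult.commute)
qed

text \<open>
  The reciprocal of the order of the centralizer of a permutation of cycle type \<open>m\<close>. Since \<open>1 / 0 = 0\<close>,
  the weight vanishes if \<open>0\<close> occurs in \<open>m\<close>, as it should: there are no cycles of length \<open>0\<close>.
\<close>

definition cycle_weight :: "nat multiset \<Rightarrow> rat" where
  "cycle_weight m = (\<Prod>j\<in>set_mset m. 1 / (of_nat j ^ count m j * fact (count m j)))"

lemma cycle_weight_empty [simp]: "cycle_weight {#} = 1"
  by (simp add: cycle_weight_def)

lemma cycle_weight_add_mset:
  "cycle_weight (add_mset j m) = cycle_weight m / (of_nat j * of_nat (Suc (count m j)))"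
proof -
  let ?f = "\<lambda>m j. 1 / (of_nat j ^ count m j * fact (count m j)) :: rat"
  let ?B = "set_mset m - {j}"
  have "cycle_weight (add_mset j m) = ?f (add_mset j m) j * prod (?f (add_mset j m)) ?B"
    unfolding cycle_weight_def set_mset_add_mset_insert
    by (subst prod.remove[of _ j]) (simp_all add: insert_Diff_if)
  also have "prod (?f (add_mset j m)) ?B = prod (?f m) ?B"
    by (rule prod.cong) auto
  also have "?f (add_mset j m) j = ?f m j / (of_nat j * of_nat (Suc (count m j)))"
    by (simp add: field_simps)
  also have "?f m j / (of_nat j * of_nat (Suc (count m j))) * prod (?f m) ?B =
      (?f m j * prod (?f m) ?B) / (of_nat j * of_nat (Suc (count m j)))"
    by simp
  also have "?f m j * prod (?f m) ?B = cycle_weight m"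
  proof (cases "j \<in># m")
    case True
    then show ?thesis unfolding cycle_weight_def by (subst prod.remove[of _ j]) simp_all
  next
    case False
    then show ?thesis unfolding cycle_weight_def by (simp add: not_in_iff)
  qed
  finally show ?thesis .
qed

lemma cycle_weight_remove:
  assumes "j \<in># m" "j > 0"
  shows "cycle_weight (m - {#j#}) = of_nat (j * count m j) * cycle_weight m"
proof -
  define n where "n = m - {#j#}"
  have m: "m = add_mset j n" using assms by (simp add: n_def)
  show ?thesis unfolding n_def[symmetric] unfolding m cycle_weight_add_mset
    using assms(2) by (simp add: of_nat_mult del: of_nat_Suc mult_Suc_right)
qed

lemma cycle_weight_eq_0: "0 \<in># m \<Longrightarrow> cycle_weight m = 0"
  by (metis cycle_weight_add_mset insert_DiffM of_nat_0 mult_zero_left div_by_0)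

lemma sum_mset_eq_sum_count:
  fixes f :: "'c \<Rightarrow> 'b::comm_semiring_1"
  shows "(\<Sum>x\<in>#M. f x) = (\<Sum>x\<in>set_mset M. of_nat (count M x) * f x)"
proof -
  have "(\<Sum>x\<in>A. of_nat (count M x) * f x) = (\<Sum>x\<in>#M. f x)" if "finite A" "set_mset M \<subseteq> A" for A
    using that(2)
  proof (induction M)
    case (add y M)
    have "(\<Sum>x\<in>A. of_nat (count (add_mset y M) x) * f x) =
        (\<Sum>x\<in>A. (if y = x then f x else 0) + of_nat (count M x) * f x)"
      by (rule sum.cong) (auto simp: distrib_right)
    then show ?case using add that(1) by (simp add: sum.distrib)
  qed simp
  then show ?thesis by simp
qed

text \<open>
  By induction along \<open>sum_over_cycle_types_insert\<close>, grouped by the length \<open>s\<close> of the cycle that contains the new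
  point. Removing that point leaves the type \<open>m - {#s#}\<close> with a part \<open>s - 1\<close> added (or nothing, for
  \<open>s = 1\<close>), and each \<open>s\<close> accounts for the share \<open>s * count m s\<close> of the sum of all parts.
\<close>

lemma card_permutations_of_cycle_type:
  assumes "finite A"
  shows "of_nat (card {\<sigma>. \<sigma> permutes A \<and> cycle_type A \<sigma> = m}) =
    (if sum_mset m = card A then fact (card A) * cycle_weight m else 0)"
  using assms
proof (induction A arbitrary: m rule: finite_induct)
  case empty
  have "cycle_type {} \<sigma> = {#}" for \<sigma> :: "'a \<Rightarrow> 'a" by (simp add: cycle_type_def)
  moreover have "cycle_weight m = 0" if "sum_mset m = 0" "m \<noteq> {#}"
    using that by (metis cycle_weight_eq_0 multiset_nonemptyE sum_mset_0_iff)
  ultimately show ?case by (cases "m = {#}") auto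
next
  case (insert a A)
  let ?T = "cycle_type A"
  define N where "N m = (of_nat (card {\<sigma>. \<sigma> permutes A \<and> ?T \<sigma> = m}) :: rat)" for m
  have finp: "finite {\<sigma>. \<sigma> permutes A}" using insert.hyps(1) by (rule finite_permutations)
  have N: "N m = (\<Sum>\<sigma> | \<sigma> permutes A. if ?T \<sigma> = m then 1 else 0)" for m
    unfolding N_def sum_indicator[OF finp] by simp
  let ?shrink = "\<lambda>s. add_mset (s - 1) (m - {#s#})"
  have "of_nat (card {\<sigma>. \<sigma> permutes insert a A \<and> cycle_type (insert a A) \<sigma> = m}) =
      (\<Sum>\<sigma> | \<sigma> permutes insert a A. if cycle_type (insert a A) \<sigma> = m then 1 else 0 :: rat)"
    by (subst sum_indicator) (simp_all add: finite_permutations insert.hyps)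
  also have "\<dots> = (\<Sum>\<sigma> | \<sigma> permutes A. (if add_mset 1 (?T \<sigma>) = m then 1 else 0) +
       (\<Sum>l\<in>#?T \<sigma>. of_nat l * (if add_mset (Suc l) (?T \<sigma> - {#l#}) = m then 1 else 0)))"
    by (rule sum_over_cycle_types_insert[OF insert.hyps])
  also have "\<dots> = (\<Sum>\<sigma> | \<sigma> permutes A. (if 1 \<in># m then 1 else 0) * (if ?T \<sigma> = m - {#1#} then 1 else 0) +
       (\<Sum>s\<in>set_mset m. of_nat ((s - 1) * count (?shrink s) (s - 1)) * (if ?T \<sigma> = ?shrink s then 1 else 0)))"
  proof (intro sum.cong refl arg_cong2[where f = "(+)"])
    fix \<sigma>
    show "(if add_mset 1 (?T \<sigma>) = m then 1 else 0) = (if 1 \<in># m then 1 else 0) * (if ?T \<sigma> = m - {#1#} then 1 else 0 :: rat)"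
      by auto
    let ?R = "?T \<sigma>"
    have "(\<Sum>l\<in>#?R. of_nat l * (if add_mset (Suc l) (?R - {#l#}) = m then 1 else 0 :: rat)) =
       (\<Sum>l\<in>set_mset ?R. of_nat (count ?R l * l) * (if add_mset (Suc l) (?R - {#l#}) = m then 1 else 0))"
      by (simp add: sum_mset_eq_sum_count mult.assoc)
    also have "\<dots> = (\<Sum>s\<in>set_mset m. of_nat ((s - 1) * count (?shrink s) (s - 1)) * (if ?R = ?shrink s then 1 else 0))"
    proof -
      let ?S = "{l \<in> set_mset ?R. 0 < l \<and> add_mset (Suc l) (?R - {#l#}) = m}"
      let ?S' = "{s \<in> set_mset m. 1 < s \<and> ?R = ?shrink s}"
      have "(\<Sum>l\<in>set_mset ?R. of_nat (count ?R l * l) * (if add_mset (Suc l) (?R - {#l#}) = m then 1 else 0 :: rat)) =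
          (\<Sum>l\<in>?S. of_nat (count ?R l * l))"
        by (rule sum.mono_neutral_cong_right) auto
      also have "\<dots> = (\<Sum>s\<in>?S'. of_nat ((s - 1) * count (?shrink s) (s - 1)))"
        by (rule sum.reindex_bij_witness[where i = "\<lambda>s. s - 1" and j = Suc]) (auto simp: algebra_simps)
      also have "\<dots> = (\<Sum>s\<in>set_mset m. of_nat ((s - 1) * count (?shrink s) (s - 1)) * (if ?R = ?shrink s then 1 else 0))"
      proof (rule sum.mono_neutral_cong_left)
        have "of_nat ((s - 1) * c) * (if Q then 1 else 0) = (0 :: rat)" if "\<not> (1 < s \<and> Q)" for s c Q
          using that by (cases "s - 1") auto
        then show "\<forall>s\<in>set_mset m - ?S'. of_nat ((s - 1) * count (?shrink s) (s - 1)) * (if ?R = ?shrink s then 1 else 0) = (0 :: rat)"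
          by blast
      qed auto
      finally show ?thesis .
    qed
    finally show "(\<Sum>l\<in>#?R. of_nat l * (if add_mset (Suc l) (?R - {#l#}) = m then 1 else 0 :: rat)) = \<dots>" .
  qed
  also have "\<dots> = (if 1 \<in># m then 1 else 0) * N (m - {#1#}) +
      (\<Sum>s\<in>set_mset m. of_nat ((s - 1) * count (?shrink s) (s - 1)) * N (?shrink s))"
    unfolding N sum.distrib sum_distrib_left by (subst sum.swap) simp
  also have "\<dots> = (\<Sum>s\<in>set_mset m. if s = 0 \<or> sum_mset m \<noteq> Suc (card A) then 0
      else fact (card A) * cycle_weight (m - {#s#}))"
  proof -
    have IH: "N m' = (if sum_mset m' = card A then fact (card A) * cycle_weight m' else 0)" for m'
      unfolding N_def by (rule insert.IH)
    have size: "sum_mset (m - {#s#}) + s = sum_mset m" if "s \<in># m" for s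
      using that by (metis add.commute insert_DiffM sum_mset.add_mset)
    have "(if 1 \<in># m then 1 else 0) * N (m - {#1#}) = (\<Sum>s\<in>set_mset m. if s = 1 then N (m - {#1#}) else 0)"
      by simp
    moreover have "(if s = 1 then N (m - {#1#}) else 0) + of_nat ((s - 1) * count (?shrink s) (s - 1)) * N (?shrink s) =
      (if s = 0 \<or> sum_mset m \<noteq> Suc (card A) then 0 else fact (card A) * cycle_weight (m - {#s#}))"
      if s: "s \<in># m" for s
    proof -
      consider "s = 0" | "s = 1" | r where "s = Suc (Suc r)" by (metis One_nat_def not0_implies_Suc)
      then show ?thesis
      proof cases
        case 3
        have "of_nat (Suc r * count (?shrink s) (Suc r)) * cycle_weight (?shrink s) = cycle_weight (m - {#s#})"
          using cycle_weight_remove[of "Suc r" "?shrink s"] 3 by simp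
        then show ?thesis using size[OF s] 3 by (auto simp: IH)
      qed (use size[OF s] in \<open>auto simp: IH\<close>)
    qed
    ultimately show ?thesis by (simp only: sum.distrib[symmetric]) (simp cong: sum.cong)
  qed
  also have "\<dots> = (if sum_mset m = Suc (card A) then
      fact (card A) * (\<Sum>s\<in>set_mset m. of_nat (s * count m s)) * cycle_weight m else 0)"
  proof (cases "sum_mset m = Suc (card A)")
    case True
    then show ?thesis
      unfolding sum_distrib_left sum_distrib_right
      by (auto intro!: sum.cong simp: cycle_weight_remove)
  qed simp
  also have "(\<Sum>s\<in>set_mset m. of_nat (s * count m s)) = (of_nat (sum_mset m) :: rat)"
    using sum_mset_eq_sum_count[of "\<lambda>s. s" m] by (simp add: mult.commute)
  finally show ?case using insert.hyps by simp
qed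

section \<open>Isomorphism classes\<close>

lemma finite_structures:
  assumes "is_species F" "finite U" shows "finite (structures F U)"
proof -
  have "\<forall>U. finite U \<longrightarrow> finite (structures F U)"
    using assms(1) unfolding is_species_def by (elim conjE)
  with assms(2) show ?thesis by simp
qed

lemma transport_permutes:
  assumes F: "is_species F" and fin: "finite U" and s: "s \<in> structures F U" and \<sigma>: "\<sigma> permutes U"
  shows "transport F U \<sigma> s \<in> structures F U"
proof -
  have "\<forall>U V \<sigma>. finite U \<and> bij_betw \<sigma> U V \<longrightarrow> (\<forall>s\<in>structures F U. transport F U \<sigma> s \<in> structures F V)"
    using F unfolding is_species_def by (elim conjE)
  then show ?thesis using fin s permutes_imp_bij[OF \<sigma>] by simp
qed

lemma transport_id:
  assumes F: "is_species F" and fin: "finite U" and s: "s \<in> structures F U"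
  shows "transport F U id s = s"
proof -
  have "\<forall>U. finite U \<longrightarrow> (\<forall>s\<in>structures F U. transport F U id s = s)"
    using F unfolding is_species_def by (elim conjE)
  then show ?thesis using fin s by simp
qed

lemma transport_comp:
  assumes F: "is_species F" and fin: "finite U" and s: "s \<in> structures F U"
    and \<sigma>: "\<sigma> permutes U" and \<tau>: "\<tau> permutes U"
  shows "transport F U (\<tau> \<circ> \<sigma>) s = transport F U \<tau> (transport F U \<sigma> s)"
proof -
  have "\<forall>U V W \<sigma> \<tau>. finite U \<and> bij_betw \<sigma> U V \<and> bij_betw \<tau> V W \<longrightarrow>
      (\<forall>s\<in>structures F U. transport F U (\<tau> \<circ> \<sigma>) s = transport F V \<tau> (transport F U \<sigma> s))"
    using F unfolding is_species_def by (elim conjE)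
  from this[rule_format, OF conjI[OF fin conjI[OF permutes_imp_bij[OF \<sigma>] permutes_imp_bij[OF \<tau>]]] s]
  show ?thesis .
qed

text \<open>
  All \<open>n!\<close> permutations map \<open>s\<close> into its class, and those that map it to a given \<open>t\<close> form a coset of the
  stabilizer of \<open>t\<close>.
\<close>

lemma sum_fix_counts_on_class:
  assumes F: "is_species F" and s: "s \<in> structures F {1..n}"
  shows "(\<Sum>t\<in>iso_rel F n `` {s}. card {\<sigma>. \<sigma> permutes {1..n} \<and> transport F {1..n} \<sigma> t = t}) = fact n"
proof -
  let ?U = "{1..n}" and ?C = "iso_rel F n `` {s}"
  let ?tr = "transport F {1..n}"
  have equiv: "equiv (structures F ?U) (iso_rel F n)" by (rule equiv_iso_rel[OF F])
  have fin: "finite (structures F ?U)" by (rule finite_structures[OF F]) simp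
  note mem = transport_permutes[OF F finite_atLeastAtMost]
    and comp = transport_comp[OF F finite_atLeastAtMost]
    and ident = transport_id[OF F finite_atLeastAtMost]
  have C: "?C \<subseteq> structures F ?U" by (auto simp: iso_rel_def)
  have finC: "finite ?C" by (rule finite_subset[OF C fin])
  have "card {\<sigma>. \<sigma> permutes ?U \<and> ?tr \<sigma> t = t} = card {\<sigma> \<in> {\<sigma>. \<sigma> permutes ?U}. ?tr \<sigma> s = t}"
    if t: "t \<in> ?C" for t
  proof -
    from t obtain \<tau> where \<tau>: "\<tau> permutes ?U" "?tr \<tau> s = t" by (auto simp: iso_rel_def)
    have s_back: "?tr (inv \<tau>) t = s"
      using comp[OF s \<tau>(1) permutes_inv[OF \<tau>(1)]] \<tau> ident[OF s] by (simp add: permutes_inv_o)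
    have tU: "t \<in> structures F ?U" using t C by blast
    have "bij_betw (\<lambda>\<sigma>. \<sigma> \<circ> \<tau>) {\<sigma>. \<sigma> permutes ?U \<and> ?tr \<sigma> t = t} {\<sigma> \<in> {\<sigma>. \<sigma> permutes ?U}. ?tr \<sigma> s = t}"
    proof (rule bij_betw_byWitness[where f' = "\<lambda>\<sigma>. \<sigma> \<circ> inv \<tau>"])
      show "(\<lambda>\<sigma>. \<sigma> \<circ> \<tau>) ` {\<sigma>. \<sigma> permutes ?U \<and> ?tr \<sigma> t = t} \<subseteq> {\<sigma> \<in> {\<sigma>. \<sigma> permutes ?U}. ?tr \<sigma> s = t}"
        using \<tau> permutes_compose[OF \<tau>(1)] comp[OF s \<tau>(1)] by auto
      show "(\<lambda>\<sigma>. \<sigma> \<circ> inv \<tau>) ` {\<sigma> \<in> {\<sigma>. \<sigma> permutes ?U}. ?tr \<sigma> s = t} \<subseteq> {\<sigma>. \<sigma> permutes ?U \<and> ?tr \<sigma> t = t}"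
        using s_back permutes_compose[OF permutes_inv[OF \<tau>(1)]] comp[OF tU permutes_inv[OF \<tau>(1)]] by auto
    qed (simp_all add: comp_assoc permutes_inv_o[OF \<tau>(1)])
    then show ?thesis by (rule bij_betw_same_card)
  qed
  then have "(\<Sum>t\<in>?C. card {\<sigma>. \<sigma> permutes ?U \<and> ?tr \<sigma> t = t}) =
      (\<Sum>t\<in>?C. \<Sum>\<sigma>\<in>{\<sigma> \<in> {\<sigma>. \<sigma> permutes ?U}. ?tr \<sigma> s = t}. 1)"
    by simp
  also have "\<dots> = (\<Sum>\<sigma> | \<sigma> permutes ?U. 1)"
  proof (rule sum.group)
    show "finite {\<sigma>. \<sigma> permutes ?U}" by (simp add: finite_permutations)
    show "finite ?C" by (rule finC)
    show "(\<lambda>\<sigma>. ?tr \<sigma> s) ` {\<sigma>. \<sigma> permutes ?U} \<subseteq> ?C"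
      using s mem[OF s] by (auto simp: iso_rel_def)
  qed
  also have "\<dots> = fact n" using card_permutations[of ?U n] by simp
  finally show ?thesis .
qed

text \<open>
  The orbit-counting lemma of Cauchy, Frobenius and Burnside, for the symmetric group acting on structures.
\<close>

lemma type_gen_series_nth:
  assumes F: "is_species F"
  shows "type_gen_series F $ n = (\<Sum>\<sigma> | \<sigma> permutes {1..n}. of_nat (fix_count F n \<sigma>)) / fact n"
proof -
  let ?U = "{1..n}"
  let ?X = "structures F ?U" and ?P = "{\<sigma>. \<sigma> permutes {1..n}}"
  let ?fixes = "\<lambda>\<sigma> s. if transport F ?U \<sigma> s = s then 1 else 0 :: nat"
  have finX: "finite ?X" by (rule finite_structures[OF F]) simp
  have finP: "finite ?P" by (simp add: finite_permutations)
  have equiv: "equiv ?X (iso_rel F n)" by (rule equiv_iso_rel[OF F])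
  have "(\<Sum>\<sigma>\<in>?P. fix_count F n \<sigma>) = (\<Sum>\<sigma>\<in>?P. \<Sum>s\<in>?X. ?fixes \<sigma> s)"
    unfolding fix_count_def by (subst sum_indicator[OF finX]) simp
  also have "\<dots> = (\<Sum>s\<in>?X. \<Sum>\<sigma>\<in>?P. ?fixes \<sigma> s)" by (rule sum.swap)
  also have "\<dots> = (\<Sum>s\<in>?X. card {\<sigma>. \<sigma> permutes ?U \<and> transport F ?U \<sigma> s = s})"
    by (subst sum_indicator[OF finP]) simp
  also have "\<dots> = (\<Sum>C\<in>?X // iso_rel F n. \<Sum>s\<in>C. card {\<sigma>. \<sigma> permutes ?U \<and> transport F ?U \<sigma> s = s})"
  proof -
    have "finite C" if "C \<in> ?X // iso_rel F n" for C
      using finite_equiv_class[OF finX _ that] equiv equiv_type by blast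
    moreover have "C \<inter> D = {}" if "C \<in> ?X // iso_rel F n" "D \<in> ?X // iso_rel F n" "C \<noteq> D" for C D
      using quotient_disj[OF equiv that(1,2)] that(3) by blast
    ultimately have "sum g (\<Union>(?X // iso_rel F n)) = (\<Sum>C\<in>?X // iso_rel F n. sum g C)" for g :: "_ \<Rightarrow> nat"
      using sum.Union_disjoint[of "?X // iso_rel F n" g] by auto
    then show ?thesis unfolding Union_quotient[OF equiv] .
  qed
  also have "\<dots> = (\<Sum>C\<in>?X // iso_rel F n. fact n)"
  proof (rule sum.cong[OF refl])
    fix C assume "C \<in> ?X // iso_rel F n"
    then obtain s where "s \<in> ?X" "C = iso_rel F n `` {s}" by (auto elim: quotientE)
    then show "(\<Sum>s\<in>C. card {\<sigma>. \<sigma> permutes ?U \<and> transport F ?U \<sigma> s = s}) = fact n"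
      using sum_fix_counts_on_class[OF F] by simp
  qed
  finally have "(\<Sum>\<sigma>\<in>?P. fix_count F n \<sigma>) = card (?X // iso_rel F n) * fact n" by simp
  then have "(\<Sum>\<sigma>\<in>?P. of_nat (fix_count F n \<sigma>)) = (of_nat (card (?X // iso_rel F n)) * fact n :: rat)"
    by (metis of_nat_sum of_nat_mult of_nat_fact)
  then show ?thesis by (simp add: type_gen_series_def)
qed

section \<open>The type generating series\<close>

text \<open>
  The number of structures fixed by \<open>\<sigma>\<close> depends on the number of cycles of \<open>\<sigma>\<close> only. Both the type generating
  series and the cycle index series rest on this.
\<close>

lemma fix_count_interval_orders:
  assumes \<sigma>: "\<sigma> permutes {1..n}"
  shows "of_nat (fix_count interval_order_species n \<sigma>) =
    fact (card (orbit \<sigma> ` {1..n})) * gen_series interval_order_species $ card (orbit \<sigma> ` {1..n})"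
proof -
  have "fix_count interval_order_species n \<sigma> = card (interval_orders (orbit \<sigma> ` {1..n}))"
    using card_fixed_interval_orders[OF _ \<sigma>] by (simp add: fix_count_def interval_order_species_def)
  also have "\<dots> = card (interval_orders {1..card (orbit \<sigma> ` {1..n})})"
    by (rule card_interval_orders_eq) auto
  finally show ?thesis by (simp add: gen_series_def interval_order_species_def)
qed

text \<open>
  The linear functional \<open>f \<mapsto> [x\<^sup>n] f (- log (1 - x))\<close>. Only its values on exponentials are needed, so it
  is defined by the sum over permutations in which it occurs, and no composition with a logarithm appears.
\<close>

definition cycle_transform :: "nat \<Rightarrow> rat fps \<Rightarrow> rat" where
  "cycle_transform n f =
     (\<Sum>\<sigma> | \<sigma> permutes {1..n}. fact (card (orbit \<sigma> ` {1..n})) * f $ card (orbit \<sigma> ` {1..n})) / fact n"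

lemma cycle_transform_sum: "cycle_transform n (\<Sum>x\<in>X. f x) = (\<Sum>x\<in>X. cycle_transform n (f x))"
  unfolding cycle_transform_def fps_sum_nth sum_distrib_left
  by (subst sum.swap) (simp add: sum_divide_distrib)

lemma cycle_transform_cong: "(\<And>k. k \<le> n \<Longrightarrow> f $ k = g $ k) \<Longrightarrow> cycle_transform n f = cycle_transform n g"
  unfolding cycle_transform_def
  by (intro arg_cong2[where f = "(/)"] sum.cong refl) (metis card_atLeastAtMost card_image_le diff_Suc_1 finite_atLeastAtMost)

lemma cycle_transform_exp: "cycle_transform n (fps_exp c) = pochhammer c n / fact n"
  using sum_power_cycle_number[of "{1..n}" c] by (simp add: cycle_transform_def)

lemma one_minus_X_power_nth: "(1 - fps_X :: rat fps) ^ j $ n = pochhammer (- of_nat j) n / fact n"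
proof (induction j arbitrary: n)
  case 0
  then show ?case by (cases n) (auto simp: pochhammer_0_left)
next
  case (Suc j)
  have "(1 - fps_X :: rat fps) ^ Suc j $ n = (1 - fps_X) ^ j $ n - (fps_X * (1 - fps_X) ^ j) $ n"
    by (simp add: algebra_simps)
  also have "\<dots> = pochhammer (- of_nat (Suc j)) n / fact n"
  proof (cases n)
    case (Suc k)
    have "pochhammer (- of_nat j :: rat) (Suc k) = pochhammer (- of_nat j) k * (- of_nat j + of_nat k)"
      by (rule pochhammer_Suc)
    moreover have "pochhammer (- of_nat (Suc j) :: rat) (Suc k) = - of_nat (Suc j) * pochhammer (- of_nat j) k"
      by (subst pochhammer_rec) simp
    moreover have "pochhammer (- of_nat j) k / fact k = of_nat (Suc k) * pochhammer (- of_nat j :: rat) k / fact (Suc k)"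
      by (simp del: of_nat_Suc)
    ultimately show ?thesis
      by (simp only: Suc fps_X_mult_nth Suc.IH)
         (simp add: Suc.IH diff_divide_distrib[symmetric] algebra_simps del: fact_Suc)
  qed (simp add: Suc.IH)
  finally show ?case .
qed

text \<open>
  Both products expand into signed sums over subsets \<open>S\<close> of \<open>{1..m}\<close>, and the functional maps
  the exponential \<open>fps_exp (- of_nat j)\<close> to the coefficient of \<open>(1 - fps_X) ^ j\<close>, here with \<open>j = \<Sum>S\<close>.
\<close>

lemma cycle_transform_fishburn_prod:
  "cycle_transform n (fishburn_prod m) = (\<Prod>i=1..m. 1 - (1 - fps_X) ^ i) $ n"
proof -
  have exp: "(\<Prod>i\<in>S. fps_exp (- of_nat i :: rat)) = fps_exp (- of_nat (\<Sum>S))" for S :: "nat set"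
    by (induction S rule: infinite_finite_induct) (simp_all flip: fps_exp_add_mult)
  have "fishburn_prod m = (\<Sum>S\<in>Pow {1..m}. (-1) ^ card S * fps_exp (- of_nat (\<Sum>S)))"
    unfolding fishburn_prod_def by (subst prod_diff_conv_sum) (simp_all add: exp)
  moreover have "cycle_transform n ((-1) ^ k * f) = (-1) ^ k * cycle_transform n f" for k f
    by (cases "even k") (simp_all add: cycle_transform_def sum_negf)
  moreover have "(\<Prod>i=1..m. 1 - (1 - fps_X :: rat fps) ^ i) = (\<Sum>S\<in>Pow {1..m}. (-1) ^ card S * (1 - fps_X) ^ \<Sum>S)"
    by (subst prod_diff_conv_sum) (simp_all add: power_sum)
  moreover have "((-1) ^ j * f) $ n = (-1) ^ j * f $ n" for j and f :: "rat fps"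
    by (cases "even j") auto
  ultimately show ?thesis
    by (simp add: cycle_transform_sum fps_sum_nth cycle_transform_exp one_minus_X_power_nth)
qed

theorem type_gen_series_sums:
  "(\<lambda>m. \<Prod>i=1..m. 1 - (1 - fps_X) ^ i) sums type_gen_series interval_order_species"
  unfolding sums_def tendsto_fps_iff eventually_sequentially
proof (intro allI exI impI)
  fix n N :: nat assume N: "Suc n \<le> N"
  have "type_gen_series interval_order_species $ n = cycle_transform n (gen_series interval_order_species)"
    unfolding type_gen_series_nth[OF is_species_interval_order_species] cycle_transform_def
    by (simp add: fix_count_interval_orders)
  also have "\<dots> = cycle_transform n (\<Sum>m<N. fishburn_prod m)"
    by (rule cycle_transform_cong) (use N in \<open>simp add: gen_series_nth_eq_sum[of _ N]\<close>)
  also have "\<dots> = (\<Sum>m<N. \<Prod>i=1..m. 1 - (1 - fps_X) ^ i) $ n"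
    by (simp add: cycle_transform_sum cycle_transform_fishburn_prod fps_sum_nth)
  finally show "(\<Sum>m<N. \<Prod>i=1..m. 1 - (1 - fps_X) ^ i) $ n = type_gen_series interval_order_species $ n" ..
qed

section \<open>Substitution into power series in several variables\<close>

lemma mfps_coeff_const_mult:
  fixes g :: "('v, 'a::comm_ring_1) mfps"
  shows "mfps_coeff (mfps_const c * g) m = c * mfps_coeff g m"
proof -
  have "mfps_coeff (mfps_const c * g) m = (\<Sum>x\<in>msplits m. if x = ({#}, m) then c * mfps_coeff g m else 0)"
    unfolding mfps_coeff_mult by (rule sum.cong) (auto simp: mfps_const_def msplits_def split: if_splits)
  also have "\<dots> = c * mfps_coeff g m"
    by (subst sum.delta) (simp_all, simp add: msplits_def)
  finally show ?thesis .
qed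

lemma mfps_coeff_suminf:
  fixes f :: "nat \<Rightarrow> ('v, 'a::comm_ring_1) mfps"
  assumes f: "summable f" and N: "\<And>n. n \<ge> N \<Longrightarrow> mfps_coeff (f n) m = 0"
  shows "mfps_coeff (suminf f) m = (\<Sum>n<N. mfps_coeff (f n) m)"
proof -
  have "eventually (\<lambda>k. mfps_coeff (\<Sum>n<k. f n) m = mfps_coeff (suminf f) m) sequentially"
    using summable_sums[OF f] unfolding sums_def mfps_tendsto_iff by blast
  moreover have "eventually (\<lambda>k. k \<ge> N) sequentially" by (rule eventually_ge_at_top)
  ultimately have "eventually (\<lambda>k. mfps_coeff (suminf f) m = (\<Sum>n<N. mfps_coeff (f n) m)) sequentially"
  proof eventually_elim
    case (elim k)
    have "(\<Sum>n<k. mfps_coeff (f n) m) = (\<Sum>n<N. mfps_coeff (f n) m)"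
      using elim(2) N by (intro sum.mono_neutral_right) auto
    with elim(1) show ?case by (simp add: mfps_coeff_sum)
  qed
  then show ?thesis by simp
qed

lemma mfps_coeff_subst:
  fixes g :: "('v, 'a::comm_ring_1) mfps"
  assumes g: "mfps_coeff g {#} = 0" and N: "size m < N"
  shows "mfps_coeff (mfps_subst f g) m = (\<Sum>k<N. f $ k * mfps_coeff (g ^ k) m)"
  unfolding mfps_subst_def
  by (subst mfps_coeff_suminf[OF summable_mfps_subst[OF g], of N])
     (use N in \<open>auto simp: mfps_coeff_const_mult mfps_coeff_power_eq_0[OF g]\<close>)

lemma mfps_subst_1: "mfps_coeff g {#} = 0 \<Longrightarrow> mfps_subst 1 g = 1"
  for g :: "('v, 'a::comm_ring_1) mfps"
  by (rule mfps_eqI) (subst mfps_coeff_subst[OF _ lessI], simp_all add: if_distrib[of "\<lambda>x. x * _"] cong: if_cong)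

lemma mfps_subst_diff:
  fixes g :: "('v, 'a::comm_ring_1) mfps"
  assumes "mfps_coeff g {#} = 0"
  shows "mfps_subst (f1 - f2) g = mfps_subst f1 g - mfps_subst f2 g"
  by (rule mfps_eqI) (simp add: mfps_coeff_subst[OF assms lessI] left_diff_distrib sum_subtractf)

lemma sum_mult_sum_swap:
  fixes F :: "_ \<Rightarrow> _ \<Rightarrow> 'a::comm_semiring_0"
  shows "(\<Sum>x\<in>M. (\<Sum>i\<in>A. F i x) * (\<Sum>j\<in>B. G j x)) = (\<Sum>i\<in>A. \<Sum>j\<in>B. \<Sum>x\<in>M. F i x * G j x)"
proof -
  have "(\<Sum>x\<in>M. (\<Sum>i\<in>A. F i x) * (\<Sum>j\<in>B. G j x)) = (\<Sum>i\<in>A. \<Sum>x\<in>M. \<Sum>j\<in>B. F i x * G j x)"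
    unfolding sum_product by (rule sum.swap)
  also have "\<dots> = (\<Sum>i\<in>A. \<Sum>j\<in>B. \<Sum>x\<in>M. F i x * G j x)"
    by (intro sum.cong refl sum.swap)
  finally show ?thesis .
qed

text \<open>
  Terms with \<open>i + j > size m\<close> vanish because \<open>g\<close> has no constant term, so the square of pairs \<open>(i, j)\<close> may be
  cut down to a triangle and rearranged by \<open>i + j\<close>.
\<close>

lemma mfps_subst_mult:
  fixes g :: "('v, 'a::comm_ring_1) mfps"
  assumes g: "mfps_coeff g {#} = 0"
  shows "mfps_subst (f1 * f2) g = mfps_subst f1 g * mfps_subst f2 g"
proof (rule mfps_eqI)
  fix m :: "'v multiset"
  let ?n = "Suc (size m)"
  let ?term = "\<lambda>i j. f1 $ i * f2 $ j * mfps_coeff (g ^ (i + j)) m"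
  have "mfps_coeff (mfps_subst f1 g * mfps_subst f2 g) m =
    (\<Sum>(a, b)\<in>msplits m. (\<Sum>i<?n. f1 $ i * mfps_coeff (g ^ i) a) * (\<Sum>j<?n. f2 $ j * mfps_coeff (g ^ j) b))"
    unfolding mfps_coeff_mult
    by (intro sum.cong refl) (auto simp: msplits_def mfps_coeff_subst[OF g, of _ ?n])
  also have "\<dots> = (\<Sum>i<?n. \<Sum>j<?n. f1 $ i * f2 $ j * (\<Sum>(a, b)\<in>msplits m. mfps_coeff (g ^ i) a * mfps_coeff (g ^ j) b))"
    unfolding case_prod_unfold sum_mult_sum_swap by (simp only: sum_distrib_left mult_ac)
  also have "\<dots> = (\<Sum>i<?n. \<Sum>j<?n. ?term i j)"
    by (simp only: power_add mfps_coeff_mult)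
  also have "\<dots> = (\<Sum>i<?n. \<Sum>j<?n - i. ?term i j)"
    by (intro sum.cong refl sum.mono_neutral_right) (auto simp: mfps_coeff_power_eq_0[OF g])
  also have "\<dots> = (\<Sum>(i, j)\<in>(SIGMA i:{..<?n}. {..<?n - i}). ?term i j)"
    by (rule sum.Sigma) auto
  also have "\<dots> = (\<Sum>(k, i)\<in>(SIGMA k:{..<?n}. {0..k}). ?term i (k - i))"
    by (rule sum.reindex_bij_witness[where i = "\<lambda>(k, i). (i, k - i)" and j = "\<lambda>(i, j). (i + j, i)"]) auto
  also have "\<dots> = (\<Sum>k<?n. (f1 * f2) $ k * mfps_coeff (g ^ k) m)"
    by (subst sum.Sigma[symmetric]) (simp_all only: fps_mult_nth sum_distrib_right, simp_all)
  finally show "mfps_coeff (mfps_subst (f1 * f2) g) m = mfps_coeff (mfps_subst f1 g * mfps_subst f2 g) m"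
    by (simp add: mfps_coeff_subst[OF g lessI])
qed

lemma mfps_const_mult: "mfps_const (a * b) = (mfps_const a * mfps_const b :: ('v, 'a::comm_ring_1) mfps)"
  by (rule mfps_eqI) (simp only: mfps_coeff_const_mult, simp add: mfps_const_def)

lemma mfps_const_power: "mfps_const (a ^ k) = (mfps_const a ^ k :: ('v, 'a::comm_ring_1) mfps)"
proof (induction k)
  case 0
  show ?case by (rule mfps_eqI) (simp add: mfps_const_def)
qed (simp add: mfps_const_mult)

lemma mfps_const_of_nat: "mfps_const (of_nat k) = (of_nat k :: ('v, 'a::comm_ring_1) mfps)"
proof (induction k)
  case 0
  show ?case by (rule mfps_eqI) (simp add: mfps_const_def)
next
  case (Suc k)
  have "mfps_const (of_nat (Suc k)) = 1 + (mfps_const (of_nat k) :: ('v, 'a) mfps)"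
    by (rule mfps_eqI) (simp add: mfps_const_def)
  then show ?case using Suc by simp
qed

lemma mfps_exp_scaled:
  fixes g :: "('v, 'a::field_char_0) mfps"
  assumes g: "mfps_coeff g {#} = 0"
  shows "mfps_exp (mfps_const c * g) = mfps_subst (fps_exp c) g"
proof (rule mfps_eqI)
  fix m :: "'v multiset"
  have g': "mfps_coeff (mfps_const c * g) {#} = 0" by (simp add: mfps_coeff_const_mult g)
  show "mfps_coeff (mfps_exp (mfps_const c * g)) m = mfps_coeff (mfps_subst (fps_exp c) g) m"
    unfolding mfps_exp_def mfps_coeff_subst[OF g lessI] mfps_coeff_subst[OF g' lessI]
    by (simp add: power_mult_distrib mfps_const_power[symmetric] mfps_coeff_const_mult)
qed

text \<open>
  Substitution is a ring homomorphism that maps \<open>fps_exp (- of_nat i)\<close> to the exponential of \<open>- (of_nat i * g)\<close>.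
\<close>

lemma mfps_subst_fishburn_prod:
  assumes g: "mfps_coeff g {#} = 0"
  shows "mfps_subst (fishburn_prod m) g = (\<Prod>i=1..m. 1 - mfps_exp (- (of_nat i * g)))"
proof (induction m)
  case 0
  then show ?case by (simp add: fishburn_prod_def mfps_subst_1[OF g])
next
  case (Suc m)
  have "mfps_const (- of_nat i) * g = - (of_nat i * g)" for i
  proof -
    have "mfps_const (- of_nat i :: rat) = (- of_nat i :: ('a, rat) mfps)"
      unfolding mfps_const_of_nat[symmetric] by (rule mfps_eqI) (simp add: mfps_const_def)
    then show ?thesis by simp
  qed
  then have "mfps_subst (fps_exp (- of_nat i)) g = mfps_exp (- (of_nat i * g))" for i
    using mfps_exp_scaled[OF g, of "- of_nat i"] by simp
  then show ?case
    using Suc by (simp only: fishburn_prod_Suc mfps_subst_mult[OF g] mfps_subst_diff[OF g] mfps_subst_1[OF g]) simp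
qed

section \<open>The cycle index series\<close>

definition cycle_var :: "(nat, rat) mfps" where
  "cycle_var = (\<Sum>j. mfps_const (1 / of_nat (Suc j)) * mfps_var (Suc j))"

lemma mfps_coeff_cycle_var_empty: "mfps_coeff cycle_var {#} = 0"
  unfolding cycle_var_def by (rule mfps_coeff_vars_empty)

lemma mfps_coeff_cycle_var:
  "mfps_coeff cycle_var m = (if size m = 1 then 1 / of_nat (sum_mset m) else 0)"
proof -
  have coeff: "mfps_coeff (mfps_const (1 / of_nat (Suc j)) * mfps_var (Suc j) :: (nat, rat) mfps) m =
      (if m = {#Suc j#} then 1 / of_nat (Suc j) else 0)" for j
    by (simp add: mfps_coeff_const_mult mfps_var_def)
  have "mfps_coeff cycle_var m = (\<Sum>j<sum_mset m. if m = {#Suc j#} then 1 / of_nat (Suc j) else 0)"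
    unfolding cycle_var_def
    by (subst mfps_coeff_suminf[OF summable_mfps_vars, of "sum_mset m"]) (auto simp only: coeff, auto)
  also have "\<dots> = (if size m = 1 then 1 / of_nat (sum_mset m) else 0)"
  proof (cases "size m = 1")
    case True
    then obtain s where s: "m = {#s#}" using size_1_singleton_mset by auto
    show ?thesis
    proof (cases s)
      case (Suc r)
      have "(\<Sum>j<sum_mset m. if m = {#Suc j#} then 1 / of_nat (Suc j) else (0::rat)) =
          (\<Sum>j<Suc r. if r = j then 1 / of_nat (Suc j) else 0)"
        unfolding s Suc by (rule sum.cong) auto
      then show ?thesis using s Suc by simp
    qed (simp add: s)
  qed (auto intro!: sum.neutral)
  finally show ?thesis .
qed

text \<open>
  This identifies \<open>cycle_var ^ k\<close>, divided by \<open>k!\<close>, as the cycle index series of the sets of \<open>k\<close> cycles.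
  The induction removes one part \<open>s\<close> of \<open>m\<close>, whose share is \<open>count m s\<close> out of \<open>size m\<close>.
\<close>

lemma mfps_coeff_cycle_var_power:
  "mfps_coeff (cycle_var ^ k) m = (if size m = k then fact k * cycle_weight m else 0)"
proof (induction k arbitrary: m)
  case 0
  then show ?case by auto
next
  case (Suc k)
  have "mfps_coeff (cycle_var ^ Suc k) m =
      (\<Sum>(a, b)\<in>msplits m. mfps_coeff cycle_var a * mfps_coeff (cycle_var ^ k) b)"
    by (simp add: mfps_coeff_mult)
  also have "\<dots> = (\<Sum>s\<in>set_mset m. 1 / of_nat s * mfps_coeff (cycle_var ^ k) (m - {#s#}))"
  proof -
    have inj: "inj_on (\<lambda>s. ({#s#}, m - {#s#})) (set_mset m)" by (auto simp: inj_on_def)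
    have "(\<Sum>(a, b)\<in>msplits m. mfps_coeff cycle_var a * mfps_coeff (cycle_var ^ k) b) =
      (\<Sum>(a, b)\<in>(\<lambda>s. ({#s#}, m - {#s#})) ` set_mset m. mfps_coeff cycle_var a * mfps_coeff (cycle_var ^ k) b)"
    proof (rule sum.mono_neutral_right)
      show "(\<lambda>s. ({#s#}, m - {#s#})) ` set_mset m \<subseteq> msplits m" by (auto simp: msplits_def)
      have "(a, b) \<in> (\<lambda>s. ({#s#}, m - {#s#})) ` set_mset m" if "a + b = m" "size a = 1" for a b
      proof -
        from that(2) obtain s where "a = {#s#}" using size_1_singleton_mset by auto
        with that(1) show ?thesis by auto
      qed
      then show "\<forall>i\<in>msplits m - (\<lambda>s. ({#s#}, m - {#s#})) ` set_mset m.
          (case i of (a, b) \<Rightarrow> mfps_coeff cycle_var a * mfps_coeff (cycle_var ^ k) b) = 0"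
        by (auto simp: msplits_def mfps_coeff_cycle_var)
    qed simp
    then show ?thesis by (simp add: sum.reindex[OF inj] mfps_coeff_cycle_var)
  qed
  also have "\<dots> = (\<Sum>s\<in>set_mset m. if size m = Suc k then fact k * of_nat (count m s) * cycle_weight m else 0)"
  proof (rule sum.cong[OF refl])
    fix s assume s: "s \<in># m"
    show "1 / of_nat s * mfps_coeff (cycle_var ^ k) (m - {#s#}) =
        (if size m = Suc k then fact k * of_nat (count m s) * cycle_weight m else 0)"
    proof (cases "s = 0")
      case True
      then show ?thesis using s by (simp add: cycle_weight_eq_0)
    next
      case False
      then show ?thesis
        using s size_Suc_Diff1[OF s] cycle_weight_remove[OF s] by (auto simp: Suc.IH)
    qed
  qed
  also have "\<dots> = (if size m = Suc k then fact (Suc k) * cycle_weight m else 0)"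
  proof (cases "size m = Suc k")
    case True
    then have "(\<Sum>s\<in>set_mset m. of_nat (count m s) :: rat) = of_nat (Suc k)"
      unfolding of_nat_sum[symmetric] size_multiset_overloaded_eq by simp
    then show ?thesis
      using True by (simp add: sum_distrib_left[symmetric] sum_distrib_right[symmetric] mult_ac)
  qed simp
  finally show ?case .
qed

lemma cycle_count_eq_count: "cycle_count n \<sigma> j = count (cycle_type {1..n} \<sigma>) j"
proof -
  have "finite (orbit \<sigma> ` {1..n})" by simp
  then show ?thesis
    by (auto simp: cycle_count_def cycle_type_def count_image_mset' intro!: arg_cong[where f = card])
qed

lemma mfps_coeff_monomial:
  "mfps_coeff (prod_mset (image_mset mfps_var M) :: ('v, 'a::comm_ring_1) mfps) m = (if m = M then 1 else 0)"
proof (induction M arbitrary: m)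
  case empty
  then show ?case by simp
next
  case (add v M)
  have "mfps_coeff (mfps_var v * prod_mset (image_mset mfps_var M) :: ('v, 'a) mfps) m =
      (\<Sum>x\<in>msplits m. if x = ({#v#}, M) then 1 else 0)"
    unfolding mfps_coeff_mult by (rule sum.cong) (auto simp: mfps_var_def add.IH split: if_splits)
  also have "\<dots> = (if m = add_mset v M then 1 else 0)"
    by (subst sum.delta) (simp_all, auto simp: msplits_def)
  finally show ?case by simp
qed

lemma cycle_monomial:
  assumes \<sigma>: "\<sigma> permutes {1..n}"
  shows "(\<Prod>j=1..n. mfps_var j ^ cycle_count n \<sigma> j) =
    (prod_mset (image_mset mfps_var (cycle_type {1..n} \<sigma>)) :: (nat, 'a::comm_ring_1) mfps)"
proof -
  let ?T = "cycle_type {1..n} \<sigma>"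
  have "set_mset ?T \<subseteq> {1..n}"
  proof
    fix j assume "j \<in># ?T"
    then obtain x where x: "x \<in> {1..n}" "j = card (orbit \<sigma> x)" by (auto simp: cycle_type_def)
    have sub: "orbit \<sigma> x \<subseteq> {1..n}" by (rule permutes_orbit_subset[OF \<sigma> x(1)])
    then have "j \<le> n" using card_mono[OF _ sub] x(2) by simp
    moreover have "j > 0"
      using self_in_orbit[OF \<sigma>, of x] finite_subset[OF sub] x(2) by (auto simp: card_gt_0_iff)
    ultimately show "j \<in> {1..n}" by simp
  qed
  then have "(\<Prod>j\<in>set_mset ?T. mfps_var j ^ count ?T j) = (\<Prod>j=1..n. mfps_var j ^ count ?T j :: (nat, 'a) mfps)"
    by (intro prod.mono_neutral_left) (auto simp: not_in_iff)
  then show ?thesis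
    by (simp add: image_prod_mset_multiplicity cycle_count_eq_count)
qed

lemma mfps_coeff_cycle_index_term:
  "mfps_coeff (cycle_index_term F n) m =
     (\<Sum>\<sigma> | \<sigma> permutes {1..n}. of_nat (fix_count F n \<sigma>) * (if cycle_type {1..n} \<sigma> = m then 1 else 0)) / fact n"
proof -
  have "mfps_coeff (\<Sum>\<sigma> | \<sigma> permutes {1..n}.
          of_nat (fix_count F n \<sigma>) * (\<Prod>j=1..n. mfps_var j ^ cycle_count n \<sigma> j) :: (nat, rat) mfps) m =
     (\<Sum>\<sigma> | \<sigma> permutes {1..n}. of_nat (fix_count F n \<sigma>) * (if cycle_type {1..n} \<sigma> = m then 1 else 0))"
    unfolding mfps_coeff_sum
    by (intro sum.cong refl)
       (simp only: mem_Collect_eq cycle_monomial mfps_const_of_nat[symmetric] mfps_coeff_const_mult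
          mfps_coeff_monomial eq_commute[of m])
  then show ?thesis by (simp add: cycle_index_term_def mfps_coeff_const_mult)
qed

lemma mfps_coeff_cycle_index:
  "mfps_coeff (cycle_index F) m = mfps_coeff (cycle_index_term F (sum_mset m)) m"
proof -
  have zero: "mfps_coeff (cycle_index_term F n) m = 0" if "n \<noteq> sum_mset m" for n
    unfolding mfps_coeff_cycle_index_term using that sum_mset_cycle_type[of _ "{1..n}"]
    by (auto intro!: sum.neutral)
  have "mfps_coeff (cycle_index F) m = (\<Sum>n<Suc (sum_mset m). mfps_coeff (cycle_index_term F n) m)"
    unfolding cycle_index_def by (rule mfps_coeff_suminf[OF summable_cycle_index]) (use zero in auto)
  also have "\<dots> = mfps_coeff (cycle_index_term F (sum_mset m)) m"
    by (simp add: zero sum.neutral)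
  finally show ?thesis .
qed

text \<open>
  At a monomial \<open>m\<close>, every permutation of cycle type \<open>m\<close> fixes the same number of interval orders, namely
  \<open>fact (size m)\<close> times the coefficient of order \<open>size m\<close> in the generating series. The proportion of these
  permutations is \<open>cycle_weight m\<close>, and \<open>fact (size m) * cycle_weight m\<close> is the coefficient of \<open>m\<close> in \<open>cycle_var ^ size m\<close>.
\<close>

theorem cycle_index_interval_orders:
  "cycle_index interval_order_species = mfps_subst (gen_series interval_order_species) cycle_var"
proof (rule mfps_eqI)
  fix m :: "nat multiset"
  let ?n = "sum_mset m" and ?I = interval_order_species
  let ?a = "gen_series ?I $ size m"
  have "mfps_coeff (cycle_index ?I) m =
      (\<Sum>\<sigma> | \<sigma> permutes {1..?n}. fact (size m) * ?a * (if cycle_type {1..?n} \<sigma> = m then 1 else 0)) / fact ?n"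
    unfolding mfps_coeff_cycle_index mfps_coeff_cycle_index_term
    by (intro arg_cong2[where f = "(/)"] sum.cong refl)
       (auto simp: fix_count_interval_orders simp flip: size_cycle_type)
  also have "\<dots> = fact (size m) * ?a * cycle_weight m"
    using card_permutations_of_cycle_type[of "{1..?n}" m]
    by (simp add: sum_distrib_left[symmetric] sum_indicator finite_permutations)
  also have "\<dots> = (\<Sum>k<Suc (size m). gen_series ?I $ k * mfps_coeff (cycle_var ^ k) m)"
    by (simp add: mfps_coeff_cycle_var_power sum.neutral)
  also have "\<dots> = mfps_coeff (mfps_subst (gen_series ?I) cycle_var) m"
    by (rule mfps_coeff_subst[OF mfps_coeff_cycle_var_empty lessI, symmetric])
  finally show "mfps_coeff (cycle_index ?I) m = mfps_coeff (mfps_subst (gen_series ?I) cycle_var) m" .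
qed

theorem subst_fishburn_prod_sums:
  fixes q :: "('v, rat) mfps"
  assumes q: "mfps_coeff q {#} = 0"
  shows "(\<lambda>m. \<Prod>i=1..m. 1 - mfps_exp (- (of_nat i * q))) sums mfps_subst (gen_series interval_order_species) q"
  unfolding sums_def mfps_tendsto_iff eventually_sequentially
proof (intro allI exI impI)
  fix m :: "'v multiset" and N assume N: "Suc (size m) \<le> N"
  have "mfps_coeff (\<Sum>j<N. \<Prod>i=1..j. 1 - mfps_exp (- (of_nat i * q))) m =
      (\<Sum>j<N. \<Sum>k<Suc (size m). fishburn_prod j $ k * mfps_coeff (q ^ k) m)"
    by (simp only: mfps_subst_fishburn_prod[OF q, symmetric] mfps_coeff_sum mfps_coeff_subst[OF q lessI])
  also have "\<dots> = (\<Sum>k<Suc (size m). (\<Sum>j<N. fishburn_prod j) $ k * mfps_coeff (q ^ k) m)"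
    unfolding fps_sum_nth sum_distrib_right by (rule sum.swap)
  also have "\<dots> = (\<Sum>k<Suc (size m). gen_series interval_order_species $ k * mfps_coeff (q ^ k) m)"
    using N by (intro sum.cong refl) (simp add: gen_series_nth_eq_sum[of _ N])
  also have "\<dots> = mfps_coeff (mfps_subst (gen_series interval_order_species) q) m"
    by (rule mfps_coeff_subst[OF q lessI, symmetric])
  finally show "mfps_coeff (\<Sum>j<N. \<Prod>i=1..j. 1 - mfps_exp (- (of_nat i * q))) m =
      mfps_coeff (mfps_subst (gen_series interval_order_species) q) m" .
qed

theorem corollary6p1:
  fixes \<I> :: "(nat, nat rel) species" and q :: "(nat, rat) mfps"
  assumes "\<I> = interval_order_species"
    and "q = (\<Sum>j. mfps_const (1 / of_nat (Suc j)) * mfps_var (Suc j))"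
  shows "(\<lambda>m. \<Prod>i=1..m. (1 - fps_exp (- of_nat i))) sums gen_series \<I> \<and>
         (\<lambda>m. \<Prod>i=1..m. (1 - (1 - fps_X) ^ i)) sums type_gen_series \<I> \<and>
         (\<lambda>m. \<Prod>i=1..m. (1 - mfps_exp (- (of_nat i * q)))) sums cycle_index \<I> \<and>
         cycle_index \<I> = mfps_subst (gen_series \<I>) q"
proof -
  have q: "mfps_coeff q {#} = 0" unfolding assms(2) by (rule mfps_coeff_vars_empty)
  have Z: "cycle_index \<I> = mfps_subst (gen_series \<I>) q"
    unfolding assms cycle_var_def[symmetric] by (rule cycle_index_interval_orders)
  show ?thesis
    using fishburn_prod_sums_gen_series type_gen_series_sums subst_fishburn_prod_sums[OF q] Z
    unfolding fishburn_prod_def[abs_def] assms(1) by simp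
qed

end
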